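(* Consider the ranking-and-selection-with-covariates problem and Procedure FDHom described in the context, and assume (A1) the linear model with independent normal sampling errors, (A2) that $\mathcal X^\intercal\mathcal X$ is nonsingular, and (A3) homoscedasticity: $\sigma_i^2(\mathbf x)\equiv\sigma_i^2<\infty$ for all $\mathbf x\in\Theta$ and $i=1,\dots,k$ (the $\sigma_i^2$ may differ across $i$). Then Procedure FDHom is statistically valid: $\mathrm{PCS}_{\mathrm E}\ge 1-\alpha$ if $h=h^{\mathrm{Hom}}_{\mathrm E}$, and $\mathrm{PCS}_{\min}\ge 1-\alpha$ if $h=h^{\mathrm{Hom}}_{\min}$.
   Context: There are $k$ alternatives. Covariates $\mathbf X_{\mathsf c}=(X_1,\dots,X_d)^\intercal$ are random with support $\Theta_{\mathsf c}\subseteq\mathbb R^d$; the augmented covariate vector is $\mathbf X=(1,X_1,\dots,X_d)^\intercal$ with support $\Theta=\{1\}\times\Theta_{\mathsf c}$. (A1) For each alternative $i$ and replication $\ell=1,2,\dots$, a sample of alternative $i$ taken at covariate value $\mathbf x\in\Theta$ is $Y_{i\ell}(\mathbf x)=\mathbf x^\intercal\boldsymbol\beta_i+\epsilon_{i\ell}(\mathbf x)$, where $\boldsymbol\beta_i\in\mathbb R^{d+1}$ is unknown, $\epsilon_{i\ell}(\mathbf x)\sim\mathcal N(0,\sigma_i^2(\mathbf x))$, and $\epsilon_{i\ell}(\mathbf x)$ is independent of $\epsilon_{i'\ell'}(\mathbf x')$ whenever $(i,\ell,\mathbf x)\ne(i',\ell',\mathbf x')$; samples are independent of $\mathbf X$.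 Fixed design: $m\ge d+1$ design points $\mathbf x_1,\dots,\mathbf x_m\in\Theta$, design matrix $\mathcal X=(\mathbf x_1,\dots,\mathbf x_m)^\intercal\in\mathbb R^{m\times(d+1)}$; each alternative may be sampled at each design point any number of times. (A2) $\mathcal X^\intercal\mathcal X$ is nonsingular. Probability of correct selection: let $i^*(\mathbf x)=\arg\max_i \mathbf x^\intercal\boldsymbol\beta_i$ and let $\widehat{i^*}(\mathbf x)$ be the (random) decision rule output by a procedure. Given an indifference-zone parameter $\delta>0$, the conditional PCS is $\mathrm{PCS}(\mathbf x)=\mathbb P\big(\mathbf x^\intercal\boldsymbol\beta_{i^*(\mathbf x)}-\mathbf x^\intercal\boldsymbol\beta_{\widehat{i^*}(\mathbf x)}<\delta\big)$, the probability being over the samples used by the procedure. Define $\mathrm{PCS}_{\mathrm E}=\mathbb E[\mathrm{PCS}(\mathbf X)]$ (expectation over the distribution of $\mathbf X$) and $\mathrm{PCS}_{\min}=\min_{\mathbf x\in\Theta}\mathrm{PCS}(\mathbf x)$. A target $1-\alpha\in(1/k,1)$ is given. Procedure FDHom. Setup: choose the form of unconditional PCS, $1-\alpha$, $\delta>0$, first-stage size $n_0\ge2$. Let $\Phi$ be the standard normal cdf and $\eta$ the pdf of the chi-squared distribution with $n_0m-d-1$ degrees of freedom. Let $h^{\mathrm{Hom}}_{\mathrm E}$ solve $\mathbb E\Big\{\int_0^\infty\Big[\int_0^\infty\Phi\Big(\frac{h}{\sqrt{(n_0m-d-1)(t^{-1}+s^{-1})\mathbf X^\intercal(\mathcal X^\intercal\mathcal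 X)^{-1}\mathbf X}}\Big)\eta(s)\,ds\Big]^{k-1}\eta(t)\,dt\Big\}=1-\alpha$ (expectation over $\mathbf X$), and $h^{\mathrm{Hom}}_{\min}$ solve the same equation with $\mathbb E$ replaced by $\min_{\mathbf x\in\Theta}$ and $\mathbf X$ by $\mathbf x$. Set $h=h^{\mathrm{Hom}}_{\mathrm E}$ if $\mathrm{PCS}_{\mathrm E}$ is used and $h=h^{\mathrm{Hom}}_{\min}$ if $\mathrm{PCS}_{\min}$ is used. Stage 1: take $n_0$ independent samples of each alternative $i$ at each design point, $\mathbf Y_{i\ell}=(Y_{i\ell}(\mathbf x_1),\dots,Y_{i\ell}(\mathbf x_m))^\intercal$, $\ell=1,\dots,n_0$; set $\widehat{\boldsymbol\beta}_i(n_0)=\frac1{n_0}(\mathcal X^\intercal\mathcal X)^{-1}\mathcal X^\intercal\sum_{\ell=1}^{n_0}\mathbf Y_{i\ell}$ and $S_i^2=\frac{1}{n_0m-1-d}\sum_{\ell=1}^{n_0}(\mathbf Y_{i\ell}-\mathcal X\widehat{\boldsymbol\beta}_i(n_0))^\intercal(\mathbf Y_{i\ell}-\mathcal X\widehat{\boldsymbol\beta}_i(n_0))$. Stage 2: set $N_i=\max\{\lceil h^2S_i^2/\delta^2\rceil,n_0\}$ and take $N_i-n_0$ further independent samples of alternative $i$ at each design point. Selection: $\widehat{\boldsymbol\beta}_i=\frac1{N_i}(\mathcal X^\intercal\mathcal X)^{-1}\mathcal X^\intercal\sum_{\ell=1}^{N_i}\mathbf Y_{i\ell}$, and return the decision rule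 $\widehat{i^*}(\mathbf x)=\arg\max_{1\le i\le k}\mathbf x^\intercal\widehat{\boldsymbol\beta}_i$. *)

theory Defs
  imports "HOL-Probability.Probability"
begin

definition std_normal_cdf :: "real \<Rightarrow> real" where
  "std_normal_cdf z = measure (density lborel std_normal_density) {..z}"

definition chisq_density :: "real \<Rightarrow> real \<Rightarrow> real" where
  "chisq_density \<nu> s =
     (if 0 < s then s powr (\<nu> / 2 - 1) * exp (- s / 2) / (2 powr (\<nu> / 2) * Gamma (\<nu> / 2)) else 0)"

text \<open>Design matrix: rows are the design points (augmented covariate vectors).\<close>

definition design_matrix :: "('m::finite \<Rightarrow> real^'p::finite) \<Rightarrow> real^'p^'m" where
  "design_matrix xs = (\<chi> j. xs j)"

text \<open>Degrees of freedom n0*m - d - 1, where m = CARD('m) and d + 1 = CARD('p).\<close>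

definition dof :: "nat \<Rightarrow> real^'p::finite^'m::finite \<Rightarrow> real" where
  "dof n0 Xd = real n0 * real CARD('m) - real CARD('p)"

text \<open>The integrand of the equation defining h (as a function of the covariate x and of h).\<close>

definition hom_G :: "nat \<Rightarrow> nat \<Rightarrow> real^'p::finite^'m::finite \<Rightarrow> real^'p \<Rightarrow> real \<Rightarrow> real" where
  "hom_G k n0 Xd x h =
     (let \<nu> = dof n0 Xd;
          q = x \<bullet> (matrix_inv (transpose Xd ** Xd) *v x)
      in LINT t:{0<..}|lborel.
           (LINT s:{0<..}|lborel.
              std_normal_cdf (h / sqrt (\<nu> * (1 / t + 1 / s) * q)) * chisq_density \<nu> s) ^ (k - 1)
           * chisq_density \<nu> t)"

definition ols :: "real^'p::finite^'m::finite \<Rightarrow> nat \<Rightarrow> (nat \<Rightarrow> real^'m) \<Rightarrow> real^'p" where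
  "ols Xd n Ys =
     scaleR (1 / real n) ((matrix_inv (transpose Xd ** Xd) ** transpose Xd) *v (\<Sum>l<n. Ys l))"

definition first_stage_var :: "real^'p::finite^'m::finite \<Rightarrow> nat \<Rightarrow> (nat \<Rightarrow> real^'m) \<Rightarrow> real" where
  "first_stage_var Xd n0 Ys =
     1 / dof n0 Xd * (\<Sum>l<n0. (Ys l - Xd *v ols Xd n0 Ys) \<bullet> (Ys l - Xd *v ols Xd n0 Ys))"

definition total_size :: "real \<Rightarrow> real \<Rightarrow> nat \<Rightarrow> real^'p::finite^'m::finite \<Rightarrow> (nat \<Rightarrow> real^'m) \<Rightarrow> nat" where
  "total_size h \<delta> n0 Xd Ys = max (nat \<lceil>h\<^sup>2 * first_stage_var Xd n0 Ys / \<delta>\<^sup>2\<rceil>) n0"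

definition fdhom_beta :: "real \<Rightarrow> real \<Rightarrow> nat \<Rightarrow> real^'p::finite^'m::finite \<Rightarrow> (nat \<Rightarrow> real^'m) \<Rightarrow> real^'p" where
  "fdhom_beta h \<delta> n0 Xd Ys = ols Xd (total_size h \<delta> n0 Xd Ys) Ys"

definition fdhom_select ::
  "nat \<Rightarrow> real \<Rightarrow> real \<Rightarrow> nat \<Rightarrow> real^'p::finite^'m::finite \<Rightarrow> (nat \<Rightarrow> nat \<Rightarrow> real^'m) \<Rightarrow> real^'p \<Rightarrow> nat" where
  "fdhom_select k h \<delta> n0 Xd Ys x =
     (LEAST i. i < k \<and> (\<forall>j<k. x \<bullet> fdhom_beta h \<delta> n0 Xd (Ys j) \<le> x \<bullet> fdhom_beta h \<delta> n0 Xd (Ys i)))"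

text \<open>Conditional PCS at covariate x: Ys i l w is the vector of samples of alternative i,
  replication l, at all design points, on outcome w.\<close>

definition fdhom_PCS ::
  "'a measure \<Rightarrow> nat \<Rightarrow> real \<Rightarrow> real \<Rightarrow> nat \<Rightarrow> real^'p::finite^'m::finite \<Rightarrow> (nat \<Rightarrow> real^'p)
    \<Rightarrow> (nat \<Rightarrow> nat \<Rightarrow> 'a \<Rightarrow> real^'m) \<Rightarrow> real^'p \<Rightarrow> real" where
  "fdhom_PCS M k h \<delta> n0 Xd \<beta> Ys x =
     measure M {\<omega> \<in> space M.
        (MAX i\<in>{..<k}. x \<bullet> \<beta> i) - x \<bullet> \<beta> (fdhom_select k h \<delta> n0 Xd (\<lambda>i l. Ys i l \<omega>) x) < \<delta>}"

end

theory Submission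
  imports Defs
begin

text \<open>
  Standardise the errors of one alternative to independent standard normals. Extending an
  orthonormal basis of the column space of the first-stage design, together with the second-stage
  coordinates, to an orthonormal basis of the whole sample space shows that the residual sum of
  squares is chi-squared and independent of the estimated mean for every fixed sample size at
  least \<open>n0\<close>; as the total sample size depends on the data only through the residuals, the
  standardised error of the final estimator is again standard normal and independent of them.

  Let \<open>i0\<close> be a best alternative. The selection is correct as soon as the estimation error of every
  other alternative exceeds that of \<open>i0\<close> by less than \<open>\<delta>\<close>. Given the data of \<open>i0\<close> these events are
  independent, and their probabilities are monotone in the error of \<open>i0\<close>; hence Chebyshev's
  association inequality bounds the probability of their intersection below by the product, for
  which \<open>N\<^sub>i \<ge> h\<^sup>2 S\<^sub>i\<^sup>2 / \<delta>\<^sup>2\<close> gives the integrand defining \<open>h\<close>. A nonpositive \<open>h\<close> would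
  make that integral at most \<open>2 ^ (1 - k) \<le> 1 / k\<close>, below the target.
\<close>

section \<open>Rotation invariance of the standard normal distribution\<close>

lemma sum_split_two:
  fixes f :: "'i \<Rightarrow> 'b :: comm_monoid_add"
  assumes "finite I" "i \<in> I" "j \<in> I" "i \<noteq> j"
  shows "sum f I = f i + f j + sum f (I - {i, j})"
proof -
  have I: "I = insert i (insert j (I - {i, j}))" using assms by auto
  show ?thesis using assms by (subst I) (simp add: add.assoc)
qed

lemma prod_split_two:
  fixes f :: "'i \<Rightarrow> 'b :: comm_monoid_mult"
  assumes "finite I" "i \<in> I" "j \<in> I" "i \<noteq> j"
  shows "prod f I = f i * f j * prod f (I - {i, j})"
proof -
  have I: "I = insert i (insert j (I - {i, j}))" using assms by auto
  show ?thesis using assms by (subst I) (simp add: mult.assoc)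
qed

lemma vimage_restrict_PiE:
  "(\<lambda>\<omega>. \<lambda>i\<in>I. X i \<omega>) -` Pi\<^sub>E I A \<inter> S = {\<omega> \<in> S. \<forall>i\<in>I. X i \<omega> \<in> A i}"
  by (auto simp: PiE_iff)

lemma distr_lborel_prod_shear_fst:
  fixes t :: real
  shows "distr (lborel \<Otimes>\<^sub>M lborel) (lborel \<Otimes>\<^sub>M lborel) (\<lambda>(x, y). (x + t * y, y)) = lborel \<Otimes>\<^sub>M lborel"
    (is "?D = ?L")
proof (rule measure_eqI)
  fix A assume "A \<in> sets ?D"
  then have A[measurable]: "A \<in> sets (borel \<Otimes>\<^sub>M borel)" by simp
  have "emeasure ?D A = (\<integral>\<^sup>+z. indicator A z \<partial>?D)" using A by (subst nn_integral_indicator) simp_all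
  also have "\<dots> = (\<integral>\<^sup>+z. indicator A (case z of (x, y) \<Rightarrow> (x + t * y, y)) \<partial>?L)"
    by (subst nn_integral_distr) simp_all
  also have "\<dots> = (\<integral>\<^sup>+y. (\<integral>\<^sup>+x. indicator A (x + t * y, y) \<partial>lborel) \<partial>lborel)"
    by (subst lborel_pair.nn_integral_snd[symmetric]) simp_all
  also have "\<dots> = (\<integral>\<^sup>+y. (\<integral>\<^sup>+x. indicator A (x, y) \<partial>lborel) \<partial>lborel)"
  proof (rule nn_integral_cong)
    fix y :: real
    show "(\<integral>\<^sup>+x. indicator A (x + t * y, y) \<partial>lborel) = (\<integral>\<^sup>+x. indicator A (x, y) \<partial>lborel)"
      by (subst (2) nn_integral_real_affine[where c=1 and t="t * y"]) (simp_all add: add.commute)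
  qed
  also have "\<dots> = emeasure ?L A"
    by (subst lborel_pair.nn_integral_snd) simp_all
  finally show "emeasure ?D A = emeasure ?L A" .
qed simp

lemma distr_lborel_prod_shear_snd:
  fixes t :: real
  shows "distr (lborel \<Otimes>\<^sub>M lborel) (lborel \<Otimes>\<^sub>M lborel) (\<lambda>(x, y). (x, y + t * x)) = lborel \<Otimes>\<^sub>M lborel"
    (is "?D = ?L")
proof (rule measure_eqI)
  fix A assume "A \<in> sets ?D"
  then have A[measurable]: "A \<in> sets (borel \<Otimes>\<^sub>M borel)" by simp
  have "emeasure ?D A = (\<integral>\<^sup>+z. indicator A z \<partial>?D)" using A by (subst nn_integral_indicator) simp_all
  also have "\<dots> = (\<integral>\<^sup>+z. indicator A (case z of (x, y) \<Rightarrow> (x, y + t * x)) \<partial>?L)"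
    by (subst nn_integral_distr) simp_all
  also have "\<dots> = (\<integral>\<^sup>+x. (\<integral>\<^sup>+y. indicator A (x, y + t * x) \<partial>lborel) \<partial>lborel)"
    by (subst lborel.nn_integral_fst[symmetric]) simp_all
  also have "\<dots> = (\<integral>\<^sup>+x. (\<integral>\<^sup>+y. indicator A (x, y) \<partial>lborel) \<partial>lborel)"
  proof (rule nn_integral_cong)
    fix x :: real
    show "(\<integral>\<^sup>+y. indicator A (x, y + t * x) \<partial>lborel) = (\<integral>\<^sup>+y. indicator A (x, y) \<partial>lborel)"
      by (subst (2) nn_integral_real_affine[where c=1 and t="t * x"]) (simp_all add: add.commute)
  qed
  also have "\<dots> = emeasure ?L A"
    by (subst lborel.nn_integral_fst) simp_all
  finally show "emeasure ?D A = emeasure ?L A" .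
qed simp

text \<open>A rotation other than the identity and the half turn is a product of three shears.\<close>

lemma distr_lborel_prod_rotation:
  fixes c s :: real
  assumes cs: "c\<^sup>2 + s\<^sup>2 = 1" and s: "s \<noteq> 0"
  shows "distr (lborel \<Otimes>\<^sub>M lborel) (lborel \<Otimes>\<^sub>M lborel) (\<lambda>(x, y). (c * x + s * y, c * y - s * x))
    = lborel \<Otimes>\<^sub>M lborel"
proof -
  define t where "t = (1 - c) / s"
  let ?L = "lborel \<Otimes>\<^sub>M lborel :: (real \<times> real) measure"
  let ?F = "\<lambda>(x, y). (x + t * y, y)" and ?G = "\<lambda>(x, y). (x, y + (- s) * x)"
  have st: "s * t = 1 - c" using s by (simp add: t_def)
  have "(s * t) * (2 - s * t) = s * s"
    unfolding st using cs by (simp add: algebra_simps power2_eq_square)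
  then have t2: "t * (2 - s * t) = s" using s by (simp add: mult.assoc)
  have eq: "?F \<circ> (?G \<circ> ?F) = (\<lambda>(x, y). (c * x + s * y, c * y - s * x))"
  proof (rule ext, clarify)
    fix x y
    have "c * x + s * y = (1 - s * t) * x + (t * (2 - s * t)) * y" using st t2 by simp
    then have 1: "c * x + s * y = x + t * y + t * (y + - s * (x + t * y))"
      by (simp add: algebra_simps)
    have "c * y - s * x = (1 - s * t) * y - s * x" using st by simp
    then have 2: "c * y - s * x = y + - s * (x + t * y)" by (simp add: algebra_simps)
    show "(?F \<circ> (?G \<circ> ?F)) (x, y) = (c * x + s * y, c * y - s * x)"
      unfolding 1 2 by simp
  qed
  have "distr ?L ?L (?F \<circ> (?G \<circ> ?F)) = distr (distr (distr ?L ?L ?F) ?L ?G) ?L ?F"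
    by (subst distr_distr, simp, simp)+ (simp add: o_assoc)
  also have "\<dots> = ?L"
    by (simp only: distr_lborel_prod_shear_fst distr_lborel_prod_shear_snd)
  finally show ?thesis by (simp only: eq)
qed

lemma prob_space_std_normal: "prob_space std_normal_distribution"
  by (rule prob_space_normal_density) simp

lemma distr_std_normal_prod_rotation:
  fixes c s :: real
  assumes cs: "c\<^sup>2 + s\<^sup>2 = 1" and s: "s \<noteq> 0"
  shows "distr (std_normal_distribution \<Otimes>\<^sub>M std_normal_distribution) (borel \<Otimes>\<^sub>M borel)
      (\<lambda>(x, y). (c * x + s * y, c * y - s * x))
    = std_normal_distribution \<Otimes>\<^sub>M std_normal_distribution"
proof -
  interpret N: prob_space std_normal_distribution by (rule prob_space_std_normal)
  let ?L = "lborel \<Otimes>\<^sub>M lborel :: (real \<times> real) measure"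
  let ?R = "\<lambda>(x, y). (c * x + s * y, c * y - s * x)"
  let ?f = "\<lambda>(x, y). ennreal (std_normal_density x) * ennreal (std_normal_density y)"
  have NN: "std_normal_distribution \<Otimes>\<^sub>M std_normal_distribution = density ?L ?f"
    by (rule pair_measure_density) (auto intro: N.sigma_finite_measure sigma_finite_lborel)
  have f: "?f (x, y) = ennreal (exp (- (x\<^sup>2 + y\<^sup>2) / 2) / (2 * pi))" for x y :: real
    by (simp add: std_normal_density_def ennreal_mult[symmetric] exp_add[symmetric] add_divide_distrib)
  have fR: "?f (?R z) = ?f z" for z
  proof (cases z)
    case (Pair x y)
    have "(c * x + s * y)\<^sup>2 + (c * y - s * x)\<^sup>2 = (c\<^sup>2 + s\<^sup>2) * (x\<^sup>2 + y\<^sup>2)"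
      by (simp add: power2_eq_square algebra_simps)
    then have "?f (c * x + s * y, c * y - s * x) = ?f (x, y)"
      unfolding f using cs by simp
    then show ?thesis by (simp add: Pair)
  qed
  have "distr (density ?L ?f) (borel \<Otimes>\<^sub>M borel) ?R = distr (density ?L (\<lambda>z. ?f (?R z))) ?L ?R"
    by (rule distr_cong) (simp_all add: fR)
  also have "\<dots> = density (distr ?L ?L ?R) ?f"
    by (subst density_distr) simp_all
  also have "\<dots> = density ?L ?f"
    by (simp only: distr_lborel_prod_rotation[OF cs s])
  finally show ?thesis by (simp only: NN)
qed

lemma distr_std_normal_uminus: "distr std_normal_distribution borel uminus = std_normal_distribution"
proof -
  have "distr std_normal_distribution borel uminus
    = distr (density lborel (\<lambda>x. ennreal (std_normal_density (- x)))) lborel uminus"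
    by (rule distr_cong) (simp_all add: std_normal_density_def)
  also have "\<dots> = density (distr lborel lborel uminus) (\<lambda>x. ennreal (std_normal_density x))"
    by (subst density_distr) simp_all
  also have "distr lborel lborel uminus = (lborel :: real measure)"
    by (rule trans[OF distr_cong lborel_distr_uminus]) simp_all
  finally show ?thesis .
qed

definition (in prob_space) iid_std_normal :: "('i \<Rightarrow> 'a \<Rightarrow> real) \<Rightarrow> 'i set \<Rightarrow> bool" where
  "iid_std_normal X I \<longleftrightarrow>
     indep_vars (\<lambda>_. borel) X I \<and> (\<forall>i\<in>I. distr M borel (X i) = std_normal_distribution)"

context prob_space
begin

lemma iid_std_normal_measurable: "iid_std_normal X I \<Longrightarrow> i \<in> I \<Longrightarrow> X i \<in> borel_measurable M"
  by (auto simp: iid_std_normal_def indep_vars_def)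

lemma iid_std_normal_subset: "iid_std_normal X I \<Longrightarrow> J \<subseteq> I \<Longrightarrow> iid_std_normal X J"
  by (auto simp: iid_std_normal_def intro: indep_vars_subset)

lemma iid_std_normal_distr_PiM:
  fixes I :: "'i set"
  assumes X: "iid_std_normal X I" and I: "finite I"
  shows "distr M (PiM I (\<lambda>_. borel)) (\<lambda>\<omega>. \<lambda>i\<in>I. X i \<omega>) = PiM I (\<lambda>_. std_normal_distribution)"
proof (cases "I = {}")
  case True
  interpret P: product_sigma_finite "\<lambda>_::'i. std_normal_distribution"
    by (simp add: product_sigma_finite_def prob_space.axioms(1)[OF prob_space_std_normal]
        finite_measure.axioms(1))
  show ?thesis unfolding True
  proof (rule P.PiM_eqI)
    fix A :: "'i \<Rightarrow> real set"
    show "emeasure (distr M (PiM {} (\<lambda>_. borel)) (\<lambda>\<omega>. \<lambda>i\<in>{}. X i \<omega>)) (Pi\<^sub>E {} A)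
        = (\<Prod>i\<in>{}. emeasure std_normal_distribution (A i))"
    proof (subst emeasure_distr)
      have "(\<lambda>\<omega>. \<lambda>i\<in>{}. X i \<omega>) -` Pi\<^sub>E {} A \<inter> space M = space M" by (auto simp: restrict_def)
      then show "emeasure M ((\<lambda>\<omega>. \<lambda>i\<in>{}. X i \<omega>) -` Pi\<^sub>E {} A \<inter> space M)
          = (\<Prod>i\<in>{}. emeasure std_normal_distribution (A i))"
        by (simp add: emeasure_space_1)
    qed (auto intro!: measurable_restrict simp: sets_PiM_empty)
  qed (auto cong: sets_PiM_cong)
next
  case False
  have "distr M (PiM I (\<lambda>_. borel)) (\<lambda>\<omega>. \<lambda>i\<in>I. X i \<omega>) = PiM I (\<lambda>i. distr M borel (X i))"
    using X False indep_vars_iff_distr_eq_PiM'[where I=I and M'="\<lambda>_. borel" and X=X]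
    by (auto simp: iid_std_normal_def indep_vars_def)
  also have "\<dots> = PiM I (\<lambda>_. std_normal_distribution)"
    using X by (auto simp: iid_std_normal_def intro!: PiM_cong)
  finally show ?thesis .
qed

lemma iid_std_normalI:
  fixes I :: "'i set"
  assumes I: "finite I" and X: "\<And>i. i \<in> I \<Longrightarrow> X i \<in> borel_measurable M"
    and eq: "\<And>A. (\<And>i. i \<in> I \<Longrightarrow> A i \<in> sets borel) \<Longrightarrow>
      prob {\<omega> \<in> space M. \<forall>i\<in>I. X i \<omega> \<in> A i} = (\<Prod>i\<in>I. measure std_normal_distribution (A i))"
  shows "iid_std_normal X I"
proof -
  interpret N: prob_space std_normal_distribution by (rule prob_space_std_normal)
  note X[measurable]
  have d: "distr M borel (X i) = std_normal_distribution" if i: "i \<in> I" for i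
  proof (rule measure_eqI)
    fix B assume "B \<in> sets (distr M borel (X i))"
    then have B[measurable]: "B \<in> sets borel" by simp
    have "X i -` B \<inter> space M = {\<omega> \<in> space M. \<forall>j\<in>I. X j \<omega> \<in> (if j = i then B else UNIV)}"
      using i by auto
    then have "prob (X i -` B \<inter> space M) = (\<Prod>j\<in>I. measure std_normal_distribution (if j = i then B else UNIV))"
      using eq[of "\<lambda>j. if j = i then B else UNIV"] by simp
    also have "\<dots> = measure std_normal_distribution B"
      using I i N.prob_space by (subst prod.remove[of I i]) simp_all
    finally show "emeasure (distr M borel (X i)) B = emeasure std_normal_distribution B"
      using i by (subst emeasure_distr) (auto simp: N.emeasure_eq_measure emeasure_eq_measure)
  qed simp
  have "indep_vars (\<lambda>_. borel) X I"
  proof (cases "I = {}")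
    case True
    then show ?thesis by (simp add: indep_vars_def indep_sets_def)
  next
    case False
    interpret P: product_sigma_finite "\<lambda>_::'i. std_normal_distribution"
      by (simp add: product_sigma_finite_def N.sigma_finite_measure_axioms)
    have "distr M (PiM I (\<lambda>_. borel)) (\<lambda>\<omega>. \<lambda>i\<in>I. X i \<omega>) = PiM I (\<lambda>_. std_normal_distribution)"
    proof (rule P.PiM_eqI[OF I])
      fix A assume A: "\<And>i. i \<in> I \<Longrightarrow> A i \<in> sets std_normal_distribution"
      have "(\<lambda>\<omega>. \<lambda>i\<in>I. X i \<omega>) -` Pi\<^sub>E I A \<inter> space M = {\<omega> \<in> space M. \<forall>i\<in>I. X i \<omega> \<in> A i}"
        by (auto simp: PiE_iff)
      then show "emeasure (distr M (PiM I (\<lambda>_. borel)) (\<lambda>\<omega>. \<lambda>i\<in>I. X i \<omega>)) (Pi\<^sub>E I A)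
          = (\<Prod>i\<in>I. emeasure std_normal_distribution (A i))"
        using A eq[of A] I
        by (subst emeasure_distr)
          (auto intro!: sets_PiM_I_finite simp: emeasure_eq_measure N.emeasure_eq_measure prod_ennreal)
    qed (simp cong: sets_PiM_cong)
    also have "\<dots> = PiM I (\<lambda>i. distr M borel (X i))"
      by (rule PiM_cong) (simp_all add: d)
    finally show ?thesis
      using indep_vars_iff_distr_eq_PiM'[where I=I and M'="\<lambda>_. borel" and X=X] False by auto
  qed
  with d show ?thesis by (simp add: iid_std_normal_def)
qed

lemma iid_std_normal_prob:
  assumes X: "iid_std_normal X I" and I: "finite I" and A: "\<And>i. i \<in> I \<Longrightarrow> A i \<in> sets borel"
  shows "prob {\<omega> \<in> space M. \<forall>i\<in>I. X i \<omega> \<in> A i} = (\<Prod>i\<in>I. measure std_normal_distribution (A i))"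
proof (cases "I = {}")
  case False
  have m: "measure std_normal_distribution (A i) = prob (X i -` A i \<inter> space M)" if "i \<in> I" for i
  proof -
    have "distr M borel (X i) = std_normal_distribution"
      using X that by (simp add: iid_std_normal_def)
    then show ?thesis using A[OF that] iid_std_normal_measurable[OF X that]
      by (metis measure_distr)
  qed
  have "{\<omega> \<in> space M. \<forall>i\<in>I. X i \<omega> \<in> A i} = (\<Inter>i\<in>I. X i -` A i \<inter> space M)" using False by auto
  then show ?thesis
    using indep_varsD_finite[of "\<lambda>_. borel" X I A] X I A False m
    by (simp add: iid_std_normal_def)
qed (simp add: prob_space)

lemma iid_std_normal_rotate:
  assumes X: "iid_std_normal X I" and I: "finite I" "i \<in> I" "j \<in> I" "i \<noteq> j"
    and cs: "c\<^sup>2 + s\<^sup>2 = (1::real)" "s \<noteq> 0"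
  shows "iid_std_normal (X(i := \<lambda>\<omega>. c * X i \<omega> + s * X j \<omega>, j := \<lambda>\<omega>. c * X j \<omega> - s * X i \<omega>)) I"
    (is "iid_std_normal ?Y I")
proof (rule iid_std_normalI[OF I(1)])
  have [measurable]: "X i \<in> borel_measurable M" "X j \<in> borel_measurable M"
    using X I by (auto intro: iid_std_normal_measurable)
  fix l assume "l \<in> I" then show "?Y l \<in> borel_measurable M"
    using X by (auto intro: iid_std_normal_measurable)
next
  interpret N: prob_space std_normal_distribution by (rule prob_space_std_normal)
  have [measurable]: "X i \<in> borel_measurable M" "X j \<in> borel_measurable M"
    using X I by (auto intro: iid_std_normal_measurable)
  fix A :: "_ \<Rightarrow> real set" assume A: "\<And>i. i \<in> I \<Longrightarrow> A i \<in> sets borel"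
  let ?N = std_normal_distribution and ?J = "I - {i, j}"
  let ?R = "\<lambda>(x, y). (c * x + s * y, c * y - s * x)"
  have Aij[measurable]: "A i \<in> sets borel" "A j \<in> sets borel" using A I by auto
  let ?S = "?R -` (A i \<times> A j) \<inter> space (borel \<Otimes>\<^sub>M borel)"
  have S[measurable]: "?S \<in> sets (borel \<Otimes>\<^sub>M borel)"
    by (rule measurable_sets[where A="borel \<Otimes>\<^sub>M borel"]) simp_all
  have fJ: "finite ?J" using I by simp
  have iv: "indep_vars (\<lambda>_. borel) X I" using X by (simp add: iid_std_normal_def)
  have ind: "indep_var (PiM {i, j} (\<lambda>_. borel)) (\<lambda>\<omega>. \<lambda>l\<in>{i, j}. X l \<omega>)
      (PiM ?J (\<lambda>_. borel)) (\<lambda>\<omega>. \<lambda>l\<in>?J. X l \<omega>)"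
    by (rule indep_var_restrict[OF iv]) (use I in auto)
  have ind2: "indep_var borel ((\<lambda>f. f i) \<circ> (\<lambda>\<omega>. \<lambda>l\<in>{i}. X l \<omega>))
      borel ((\<lambda>f. f j) \<circ> (\<lambda>\<omega>. \<lambda>l\<in>{j}. X l \<omega>))"
    by (rule indep_var_compose[OF indep_var_restrict[OF iv, of "{i}" "{j}"]]) (use I in auto)
  have "distr M (borel \<Otimes>\<^sub>M borel) (\<lambda>\<omega>. (X i \<omega>, X j \<omega>)) = distr M borel (X i) \<Otimes>\<^sub>M distr M borel (X j)"
    using ind2 unfolding indep_var_distribution_eq by (simp add: o_def)
  also have "\<dots> = ?N \<Otimes>\<^sub>M ?N" using X I by (simp add: iid_std_normal_def)
  finally have dist: "distr M (borel \<Otimes>\<^sub>M borel) (\<lambda>\<omega>. (X i \<omega>, X j \<omega>)) = ?N \<Otimes>\<^sub>M ?N" .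
  have PiEm: "Pi\<^sub>E ?J A \<in> sets (PiM ?J (\<lambda>_. borel))"
    using fJ A by (auto intro!: sets_PiM_I_finite)
  let ?T = "(\<lambda>f. (f i, f j)) -` ?S \<inter> space (PiM {i, j} (\<lambda>_. borel))"
  have T: "?T \<in> sets (PiM {i, j} (\<lambda>_. borel))"
    by (rule measurable_sets[OF _ S]) simp
  have "{\<omega> \<in> space M. \<forall>l\<in>I. ?Y l \<omega> \<in> A l}
      = (\<lambda>\<omega>. (\<lambda>l\<in>{i, j}. X l \<omega>, \<lambda>l\<in>?J. X l \<omega>)) -` (?T \<times> Pi\<^sub>E ?J A) \<inter> space M" (is "_ = ?E")
  proof (rule set_eqI)
    fix \<omega>
    have "(\<forall>l\<in>I. ?Y l \<omega> \<in> A l) \<longleftrightarrow> ?Y i \<omega> \<in> A i \<and> ?Y j \<omega> \<in> A j \<and> (\<forall>l\<in>?J. X l \<omega> \<in> A l)"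
      using I by auto
    then show "\<omega> \<in> {\<omega> \<in> space M. \<forall>l\<in>I. ?Y l \<omega> \<in> A l} \<longleftrightarrow> \<omega> \<in> ?E"
      using I by (simp add: PiE_iff space_pair_measure space_PiM conj_ac)
  qed
  then have "prob {\<omega> \<in> space M. \<forall>l\<in>I. ?Y l \<omega> \<in> A l} = prob ?E" by simp
  also have "\<dots> = prob ((\<lambda>\<omega>. \<lambda>l\<in>{i, j}. X l \<omega>) -` ?T \<inter> space M)
      * prob ((\<lambda>\<omega>. \<lambda>l\<in>?J. X l \<omega>) -` Pi\<^sub>E ?J A \<inter> space M)"
    by (rule indep_varD[OF ind T PiEm])
  finally have split: "prob {\<omega> \<in> space M. \<forall>l\<in>I. ?Y l \<omega> \<in> A l}
      = prob ((\<lambda>\<omega>. \<lambda>l\<in>{i, j}. X l \<omega>) -` ?T \<inter> space M)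
      * prob ((\<lambda>\<omega>. \<lambda>l\<in>?J. X l \<omega>) -` Pi\<^sub>E ?J A \<inter> space M)" .
  have "(\<lambda>\<omega>. \<lambda>l\<in>{i, j}. X l \<omega>) -` ?T \<inter> space M = (\<lambda>\<omega>. (X i \<omega>, X j \<omega>)) -` ?S \<inter> space M"
    using I by (auto simp: space_PiM)
  then have "prob ((\<lambda>\<omega>. \<lambda>l\<in>{i, j}. X l \<omega>) -` ?T \<inter> space M) = measure (?N \<Otimes>\<^sub>M ?N) ?S"
    by (subst dist[symmetric], subst measure_distr) simp_all
  also have "\<dots> = measure (distr (?N \<Otimes>\<^sub>M ?N) (borel \<Otimes>\<^sub>M borel) ?R) (A i \<times> A j)"
    by (subst measure_distr) (simp_all add: space_pair_measure)
  also have "\<dots> = measure ?N (A i) * measure ?N (A j)"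
    by (simp only: distr_std_normal_prod_rotation[OF cs])
      (simp add: measure_def N.emeasure_pair_measure_Times enn2real_mult)
  finally have pair: "prob ((\<lambda>\<omega>. \<lambda>l\<in>{i, j}. X l \<omega>) -` ?T \<inter> space M)
      = measure ?N (A i) * measure ?N (A j)" .
  have "(\<lambda>\<omega>. \<lambda>l\<in>?J. X l \<omega>) -` Pi\<^sub>E ?J A \<inter> space M = {\<omega> \<in> space M. \<forall>l\<in>?J. X l \<omega> \<in> A l}"
    by (rule vimage_restrict_PiE)
  then have rest: "prob ((\<lambda>\<omega>. \<lambda>l\<in>?J. X l \<omega>) -` Pi\<^sub>E ?J A \<inter> space M) = (\<Prod>l\<in>?J. measure ?N (A l))"
    using iid_std_normal_prob[OF iid_std_normal_subset[OF X, of ?J] fJ, of A] A by simp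
  show "prob {\<omega> \<in> space M. \<forall>l\<in>I. ?Y l \<omega> \<in> A l} = (\<Prod>l\<in>I. measure ?N (A l))"
    unfolding split pair rest using I by (simp add: prod_split_two)
qed

lemma iid_std_normal_flip:
  assumes X: "iid_std_normal X I" and i: "i \<in> I"
  shows "iid_std_normal (X(i := \<lambda>\<omega>. - X i \<omega>)) I"
proof -
  have "indep_vars (\<lambda>_. borel) (\<lambda>l \<omega>. (if l = i then uminus else (\<lambda>x. x)) (X l \<omega>)) I"
    using X by (intro indep_vars_compose2[where M'="\<lambda>_. borel"
      and Y="\<lambda>l. if l = i then uminus else (\<lambda>x. x)" and X=X]) (auto simp: iid_std_normal_def)
  also have "(\<lambda>l \<omega>. (if l = i then uminus else (\<lambda>x. x)) (X l \<omega>)) = X(i := \<lambda>\<omega>. - X i \<omega>)"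
    by (auto simp: fun_eq_iff)
  finally have 1: "indep_vars (\<lambda>_. borel) (X(i := \<lambda>\<omega>. - X i \<omega>)) I" .
  have "distr M borel (uminus \<circ> X i) = distr (distr M borel (X i)) borel uminus"
    by (subst distr_distr) (use X i in \<open>auto intro: iid_std_normal_measurable\<close>)
  also have "\<dots> = std_normal_distribution"
    using X i by (simp add: iid_std_normal_def distr_std_normal_uminus)
  finally show ?thesis using 1 X by (auto simp: iid_std_normal_def o_def)
qed

end

section \<open>Orthonormal systems of normal variables and the chi-squared law\<close>

definition orthonormal_on :: "'i set \<Rightarrow> 'k set \<Rightarrow> ('k \<Rightarrow> 'i \<Rightarrow> real) \<Rightarrow> bool" where
  "orthonormal_on I K e \<longleftrightarrow>
     (\<forall>k\<in>K. \<forall>l\<in>K. (\<Sum>i\<in>I. e k i * e l i) = (if k = l then 1 else 0))"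

lemma sum_mult_rotate:
  fixes u v :: "'i \<Rightarrow> real"
  assumes I: "finite I" "i \<in> I" "j \<in> I" "i \<noteq> j" and cs: "c\<^sup>2 + s\<^sup>2 = 1"
  shows "(\<Sum>l\<in>I. (u(i := c * u i + s * u j, j := c * u j - s * u i)) l
      * (v(i := c * v i + s * v j, j := c * v j - s * v i)) l) = (\<Sum>l\<in>I. u l * v l)"
proof -
  have "(c * u i + s * u j) * (c * v i + s * v j) + (c * u j - s * u i) * (c * v j - s * v i)
      = (c\<^sup>2 + s\<^sup>2) * (u i * v i + u j * v j)"
    by (simp add: algebra_simps power2_eq_square)
  then show ?thesis using I cs by (simp add: sum_split_two[OF I])
qed

context prob_space
begin

text \<open>Givens rotations annihilate the entries of \<open>e k0\<close> one by one.\<close>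

lemma iid_std_normal_concentrate:
  fixes I :: "'i set" and K :: "'k set" and e :: "'k \<Rightarrow> 'i \<Rightarrow> real"
  assumes "iid_std_normal X I" "finite I" "orthonormal_on I K e" "k0 \<in> K" "\<forall>k\<in>K. \<forall>i\<in>F. e k i = 0"
  shows "\<exists>Z e' i0. i0 \<in> I - F \<and> iid_std_normal Z I \<and> orthonormal_on I K e' \<and> (\<forall>k\<in>K. \<forall>i\<in>F. e' k i = 0)
      \<and> (\<forall>i\<in>F. Z i = X i) \<and> (\<forall>k\<in>K. \<forall>\<omega>. (\<Sum>i\<in>I. e' k i * Z i \<omega>) = (\<Sum>i\<in>I. e k i * X i \<omega>))
      \<and> (\<forall>\<omega>. (\<Sum>i\<in>I. (Z i \<omega>)\<^sup>2) = (\<Sum>i\<in>I. (X i \<omega>)\<^sup>2))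
      \<and> (\<forall>i\<in>I. e' k0 i = (if i = i0 then 1 else 0))"
  using assms
proof (induction "card {i \<in> I. e k0 i \<noteq> 0}" arbitrary: X e rule: less_induct)
  case less
  note X = less.prems(1) and I = less.prems(2) and e = less.prems(3) and k0 = less.prems(4)
    and F = less.prems(5)
  let ?S = "{i \<in> I. e k0 i \<noteq> 0}"
  have one: "(\<Sum>i\<in>I. e k0 i * e k0 i) = 1" using e k0 by (simp add: orthonormal_on_def)
  have "\<exists>i\<in>I. e k0 i \<noteq> 0"
  proof (rule ccontr)
    assume "\<not> ?thesis"
    then have "(\<Sum>i\<in>I. e k0 i * e k0 i) = 0" by (intro sum.neutral) auto
    then show False using one by simp
  qed
  then obtain i where i: "i \<in> I" "e k0 i \<noteq> 0" by blast
  then have iF: "i \<notin> F" using F k0 by blast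
  show ?case
  proof (cases "?S = {i}")
    case True
    have zero: "e k0 l = 0" if "l \<in> I" "l \<noteq> i" for l using True that by blast
    have "(\<Sum>l\<in>I. e k0 l * e k0 l) = e k0 i * e k0 i"
      using zero i I by (simp add: sum.remove[of I i])
    then have "e k0 i = 1 \<or> e k0 i = -1" using one by (metis square_eq_1_iff)
    then show ?thesis
    proof
      assume "e k0 i = 1"
      then have "\<forall>l\<in>I. e k0 l = (if l = i then 1 else 0)" using zero by simp
      then show ?thesis using X e F i iF
        by (intro exI[of _ X] exI[of _ e] exI[of _ i] conjI) (assumption | blast)+
    next
      assume m: "e k0 i = -1"
      define f where "f k = (e k)(i := - e k i)" for k
      have mult: "(\<Sum>l\<in>I. (u(i := - u i)) l * (v(i := - v i)) l) = (\<Sum>l\<in>I. u l * v l)" for u v :: "'i \<Rightarrow> real"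
        using I i by (simp add: sum.remove[of I i])
      have Zs: "(X(i := \<lambda>\<omega>. - X i \<omega>)) l \<omega> = ((\<lambda>l. X l \<omega>)(i := - X i \<omega>)) l" for l \<omega> by simp
      show ?thesis
      proof (intro exI[of _ "X(i := \<lambda>\<omega>. - X i \<omega>)"] exI[of _ f] exI[of _ i] conjI)
        show "iid_std_normal (X(i := \<lambda>\<omega>. - X i \<omega>)) I" using iid_std_normal_flip[OF X i(1)] .
        show "orthonormal_on I K f" using e unfolding orthonormal_on_def f_def by (simp only: mult)
        show "\<forall>k\<in>K. \<forall>\<omega>. (\<Sum>l\<in>I. f k l * (X(i := \<lambda>\<omega>. - X i \<omega>)) l \<omega>) = (\<Sum>l\<in>I. e k l * X l \<omega>)"
          unfolding f_def Zs using mult[of "e _" "\<lambda>l. X l _"] by blast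
        show "\<forall>\<omega>. (\<Sum>l\<in>I. ((X(i := \<lambda>\<omega>. - X i \<omega>)) l \<omega>)\<^sup>2) = (\<Sum>l\<in>I. (X l \<omega>)\<^sup>2)"
          unfolding power2_eq_square Zs using mult[of "\<lambda>l. X l _" "\<lambda>l. X l _"] by blast
        show "\<forall>l\<in>I. f k0 l = (if l = i then 1 else 0)" using zero m by (simp add: f_def)
      qed (use i iF F in \<open>auto simp: f_def\<close>)
    qed
  next
    case False
    then obtain j where j: "j \<in> I" "e k0 j \<noteq> 0" "i \<noteq> j" using i by auto
    then have jF: "j \<notin> F" using F k0 by blast
    define r where "r = sqrt ((e k0 i)\<^sup>2 + (e k0 j)\<^sup>2)"
    define c where "c = e k0 i / r"
    define s where "s = e k0 j / r"
    have r: "r > 0" using i by (auto simp: r_def sum_power2_gt_zero_iff)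
    have r2: "r\<^sup>2 = (e k0 i)\<^sup>2 + (e k0 j)\<^sup>2" by (simp add: r_def)
    have cs: "c\<^sup>2 + s\<^sup>2 = 1" using r r2[symmetric] by (simp add: c_def s_def power_divide add_divide_distrib[symmetric])
    have s: "s \<noteq> 0" using j r by (simp add: s_def)
    define Y where "Y = X(i := \<lambda>\<omega>. c * X i \<omega> + s * X j \<omega>, j := \<lambda>\<omega>. c * X j \<omega> - s * X i \<omega>)"
    define f where "f k = (e k)(i := c * e k i + s * e k j, j := c * e k j - s * e k i)" for k
    have Ys: "Y l \<omega> = ((\<lambda>l. X l \<omega>)(i := c * X i \<omega> + s * X j \<omega>, j := c * X j \<omega> - s * X i \<omega>)) l" for l \<omega>
      by (simp add: Y_def)
    note rot = sum_mult_rotate[OF I i(1) j(1) j(3) cs]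
    have fj: "f k0 j = 0" by (simp add: f_def c_def s_def)
    have "{l \<in> I. f k0 l \<noteq> 0} \<subseteq> ?S - {j}" using fj i j by (auto simp: f_def split: if_splits)
    then have "card {l \<in> I. f k0 l \<noteq> 0} \<le> card (?S - {j})" using I by (intro card_mono) auto
    also have "\<dots> < card ?S" using I j by (intro card_Diff1_less) auto
    finally have dec: "card {l \<in> I. f k0 l \<noteq> 0} < card ?S" .
    have fo: "orthonormal_on I K f" using e unfolding orthonormal_on_def f_def by (simp only: rot)
    have YX: "(\<Sum>l\<in>I. f k l * Y l \<omega>) = (\<Sum>l\<in>I. e k l * X l \<omega>)" for k \<omega>
      unfolding f_def Ys by (rule rot)
    have YY: "(\<Sum>l\<in>I. (Y l \<omega>)\<^sup>2) = (\<Sum>l\<in>I. (X l \<omega>)\<^sup>2)" for \<omega>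
      unfolding power2_eq_square Ys by (rule rot)
    have YF: "\<forall>l\<in>F. Y l = X l" using iF jF by (auto simp: Y_def)
    have fF: "\<forall>k\<in>K. \<forall>l\<in>F. f k l = 0" using F iF jF by (auto simp: f_def)
    have Yiid: "iid_std_normal Y I" unfolding Y_def by (rule iid_std_normal_rotate[OF X I i(1) j(1) j(3) cs s])
    from less.hyps[OF dec Yiid I fo k0 fF] show ?thesis
      unfolding YX YY using YF by (elim exE conjE) (intro exI conjI, assumption+, simp_all)
  qed
qed

text \<open>\<open>F\<close> holds the coordinates already aligned with earlier vectors; later rotations must not move them.\<close>

lemma iid_std_normal_extend_frozen:
  fixes I :: "'i set" and K :: "'k set" and e :: "'k \<Rightarrow> 'i \<Rightarrow> real"
  assumes "finite K" "iid_std_normal X I" "finite I" "orthonormal_on I K e" "\<forall>k\<in>K. \<forall>i\<in>F. e k i = 0" "F \<subseteq> I"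
  shows "\<exists>Z \<kappa>. iid_std_normal Z I \<and> inj_on \<kappa> K \<and> \<kappa> ` K \<subseteq> I - F \<and> (\<forall>i\<in>F. Z i = X i)
      \<and> (\<forall>k\<in>K. \<forall>\<omega>. Z (\<kappa> k) \<omega> = (\<Sum>i\<in>I. e k i * X i \<omega>))
      \<and> (\<forall>\<omega>. (\<Sum>i\<in>I. (Z i \<omega>)\<^sup>2) = (\<Sum>i\<in>I. (X i \<omega>)\<^sup>2))"
  using assms
proof (induction K arbitrary: X e F rule: finite_induct)
  case empty
  then show ?case by (intro exI[of _ X]) auto
next
  case (insert k0 K)
  note I = insert.prems(2)
  from iid_std_normal_concentrate[OF insert.prems(1-3) insertI1 insert.prems(4)]
  obtain Y f i0 where i0: "i0 \<in> I" "i0 \<notin> F" and Y: "iid_std_normal Y I"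
    and f: "orthonormal_on I (insert k0 K) f" "\<forall>k\<in>insert k0 K. \<forall>i\<in>F. f k i = 0"
    and YF: "\<forall>i\<in>F. Y i = X i"
    and YX: "\<forall>k\<in>insert k0 K. \<forall>\<omega>. (\<Sum>i\<in>I. f k i * Y i \<omega>) = (\<Sum>i\<in>I. e k i * X i \<omega>)"
    and YY: "\<forall>\<omega>. (\<Sum>i\<in>I. (Y i \<omega>)\<^sup>2) = (\<Sum>i\<in>I. (X i \<omega>)\<^sup>2)"
    and fk0: "\<forall>i\<in>I. f k0 i = (if i = i0 then 1 else 0)" by auto
  have delta: "(\<Sum>i\<in>I. f k0 i * g i) = g i0" for g :: "'i \<Rightarrow> real"
  proof -
    have "(\<Sum>i\<in>I. f k0 i * g i) = (\<Sum>i\<in>I. if i = i0 then g i else 0)"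
      using fk0 by (intro sum.cong) auto
    then show ?thesis using I i0 by simp
  qed
  have "f k i0 = 0" if k: "k \<in> K" for k
  proof -
    have "(\<Sum>i\<in>I. f k0 i * f k i) = 0" using f(1) k insert.hyps by (auto simp: orthonormal_on_def)
    then show ?thesis by (simp add: delta)
  qed
  then have fF: "\<forall>k\<in>K. \<forall>i\<in>insert i0 F. f k i = 0" using f(2) by auto
  have fK: "orthonormal_on I K f" using f(1) by (simp add: orthonormal_on_def)
  have "insert i0 F \<subseteq> I" using i0 insert.prems by auto
  from insert.IH[OF Y I fK fF this] obtain Z \<kappa> where Z: "iid_std_normal Z I" "inj_on \<kappa> K"
    "\<kappa> ` K \<subseteq> I - insert i0 F" "\<forall>i\<in>insert i0 F. Z i = Y i"
    "\<forall>k\<in>K. \<forall>\<omega>. Z (\<kappa> k) \<omega> = (\<Sum>i\<in>I. f k i * Y i \<omega>)"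
    "\<forall>\<omega>. (\<Sum>i\<in>I. (Z i \<omega>)\<^sup>2) = (\<Sum>i\<in>I. (Y i \<omega>)\<^sup>2)" by auto
  have "\<forall>\<omega>. Z i0 \<omega> = (\<Sum>i\<in>I. e k0 i * X i \<omega>)" using Z(4) YX delta by (metis insertI1)
  then have "\<forall>k\<in>insert k0 K. \<forall>\<omega>. Z ((\<kappa>(k0 := i0)) k) \<omega> = (\<Sum>i\<in>I. e k i * X i \<omega>)"
    using Z(5) YX by simp
  moreover have "inj_on (\<kappa>(k0 := i0)) (insert k0 K)"
    using Z(2,3) insert.hyps by (auto simp: inj_on_def)
  moreover have "(\<kappa>(k0 := i0)) ` insert k0 K \<subseteq> I - F" using Z(3) i0 by auto
  moreover have "\<forall>i\<in>F. Z i = X i" using Z(4) YF by simp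
  moreover have "\<forall>\<omega>. (\<Sum>i\<in>I. (Z i \<omega>)\<^sup>2) = (\<Sum>i\<in>I. (X i \<omega>)\<^sup>2)" using Z(6) YY by simp
  ultimately show ?case using Z(1) by blast
qed

lemma iid_std_normal_extend:
  assumes "finite K" "iid_std_normal X I" "finite I" "orthonormal_on I K e"
  obtains Z \<kappa> where "iid_std_normal Z I" "inj_on \<kappa> K" "\<kappa> ` K \<subseteq> I"
    "\<And>k \<omega>. k \<in> K \<Longrightarrow> Z (\<kappa> k) \<omega> = (\<Sum>i\<in>I. e k i * X i \<omega>)"
    "\<And>\<omega>. (\<Sum>i\<in>I. (Z i \<omega>)\<^sup>2) = (\<Sum>i\<in>I. (X i \<omega>)\<^sup>2)"
  using iid_std_normal_extend_frozen[OF assms, of "{}"] by auto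

lemma iid_std_normal_linear:
  assumes X: "iid_std_normal X I" and I: "finite I" and c: "(\<Sum>i\<in>I. (c i)\<^sup>2) = 1"
  shows "distr M borel (\<lambda>\<omega>. \<Sum>i\<in>I. c i * X i \<omega>) = std_normal_distribution"
proof -
  have "orthonormal_on I {()} (\<lambda>_. c)" using c by (simp add: orthonormal_on_def power2_eq_square)
  then obtain Z \<kappa> where Z: "iid_std_normal Z I" "\<kappa> ` {()} \<subseteq> I"
    "\<And>k \<omega>. k \<in> {()} \<Longrightarrow> Z (\<kappa> k) \<omega> = (\<Sum>i\<in>I. c i * X i \<omega>)"
    using iid_std_normal_extend[OF _ X I, of "{()}" "\<lambda>_. c" thesis] by auto
  have "Z (\<kappa> ()) = (\<lambda>\<omega>. \<Sum>i\<in>I. c i * X i \<omega>)" using Z(3) by auto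
  then show ?thesis using Z(1,2) by (auto simp: iid_std_normal_def)
qed

end

lemma PiM_std_normal_eq_density:
  assumes A: "finite A"
  shows "PiM A (\<lambda>_. std_normal_distribution)
    = density (PiM A (\<lambda>_. lborel)) (\<lambda>f. \<Prod>i\<in>A. ennreal (std_normal_density (f i)))"
proof -
  interpret N: prob_space std_normal_distribution by (rule prob_space_std_normal)
  interpret P: product_sigma_finite "\<lambda>_. std_normal_distribution"
    by (simp add: product_sigma_finite_def N.sigma_finite_measure_axioms)
  interpret L: product_sigma_finite "\<lambda>_. lborel :: real measure"
    by (simp add: product_sigma_finite_def sigma_finite_lborel)
  let ?D = "density (PiM A (\<lambda>_. lborel)) (\<lambda>f. \<Prod>i\<in>A. ennreal (std_normal_density (f i)))"
  have "?D = PiM A (\<lambda>_. std_normal_distribution)"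
  proof (rule P.PiM_eqI[OF A])
    fix B :: "'a \<Rightarrow> real set" assume B: "\<And>i. i \<in> A \<Longrightarrow> B i \<in> sets std_normal_distribution"
    have PB: "Pi\<^sub>E A B \<in> sets (PiM A (\<lambda>_. lborel))"
      using A B by (intro sets_PiM_I_finite) auto
    have "emeasure ?D (Pi\<^sub>E A B)
        = (\<integral>\<^sup>+f. (\<Prod>i\<in>A. ennreal (std_normal_density (f i))) * indicator (Pi\<^sub>E A B) f \<partial>PiM A (\<lambda>_. lborel))"
      using PB by (subst emeasure_density) auto
    also have "\<dots> = (\<integral>\<^sup>+f. (\<Prod>i\<in>A. ennreal (std_normal_density (f i)) * indicator (B i) (f i)) \<partial>PiM A (\<lambda>_. lborel))"
    proof (rule nn_integral_cong)
      fix f assume "f \<in> space (PiM A (\<lambda>_. lborel :: real measure))"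
      then have "indicator (Pi\<^sub>E A B) f = (\<Prod>i\<in>A. indicator (B i) (f i) :: ennreal)"
        using A by (auto simp: indicator_def space_PiM PiE_iff prod_zero_iff)
      then show "(\<Prod>i\<in>A. ennreal (std_normal_density (f i))) * indicator (Pi\<^sub>E A B) f
          = (\<Prod>i\<in>A. ennreal (std_normal_density (f i)) * indicator (B i) (f i))"
        by (simp add: prod.distrib)
    qed
    also have "\<dots> = (\<Prod>i\<in>A. \<integral>\<^sup>+x. ennreal (std_normal_density x) * indicator (B i) x \<partial>lborel)"
      using A B by (subst L.product_nn_integral_prod) auto
    also have "\<dots> = (\<Prod>i\<in>A. emeasure std_normal_distribution (B i))"
      using B by (intro prod.cong) (auto simp: emeasure_density)
    finally show "emeasure ?D (Pi\<^sub>E A B) = (\<Prod>i\<in>A. emeasure std_normal_distribution (B i))" .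
  qed (simp cong: sets_PiM_cong)
  then show ?thesis ..
qed

text \<open>The volume of the ball of radius \<open>sqrt r\<close> is the distribution function of this measure.\<close>

lemma distr_lborel_sum_squares:
  assumes A: "finite A" "A \<noteq> {}"
  defines "n \<equiv> real (card A)"
  shows "distr (PiM A (\<lambda>_. lborel)) borel (\<lambda>f. \<Sum>i\<in>A. (f i)\<^sup>2)
    = density lborel (\<lambda>s. ennreal (if 0 < s then unit_ball_vol n * (n / 2) * s powr (n / 2 - 1) else 0))"
    (is "?D = ?R")
proof (rule measure_eqI_generator_eq[where E="range atMost" and \<Omega>=UNIV and A="\<lambda>k. {..real k}"])
  interpret L: product_sigma_finite "\<lambda>_. lborel :: real measure"
    by (simp add: product_sigma_finite_def sigma_finite_lborel)
  have n: "n > 0" using A by (simp add: n_def card_gt_0_iff)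
  show "Int_stable (range (atMost :: real \<Rightarrow> _))"
    by (auto simp: Int_stable_def)
  show "sets ?D = sigma_sets UNIV (range atMost)" "sets ?R = sigma_sets UNIV (range atMost)"
    by (simp_all add: borel_eq_atMost)
  show "range (\<lambda>k. {..real k}) \<subseteq> range atMost" by auto
  show "(\<Union>k. {..real k}) = UNIV"
    using real_arch_simple by auto
  have meas: "(\<lambda>f. \<Sum>i\<in>A. (f i)\<^sup>2) \<in> borel_measurable (PiM A (\<lambda>_. lborel :: real measure))"
    by measurable
  have D: "emeasure ?D {..r} = ennreal (if r > 0 then unit_ball_vol n * r powr (n / 2) else 0)" for r
  proof -
    have "emeasure ?D {..r} = emeasure (PiM A (\<lambda>_. lborel))
        ({f. (\<Sum>i\<in>A. (f i)\<^sup>2) \<le> r} \<inter> space (PiM A (\<lambda>_. lborel)))"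
      by (subst emeasure_distr[OF meas]) (auto intro!: arg_cong2[where f=emeasure])
    also have "\<dots> = ennreal (if r > 0 then unit_ball_vol n * r powr (n / 2) else 0)"
    proof (cases "r > 0")
      case True
      then have "{f. (\<Sum>i\<in>A. (f i)\<^sup>2) \<le> r} = {f. sqrt (\<Sum>i\<in>A. (f i)\<^sup>2) \<le> sqrt r}" by simp
      moreover have "sqrt r ^ card A = r powr (n / 2)"
        using True by (simp add: powr_half_sqrt[symmetric] powr_powr powr_realpow[symmetric] n_def)
      ultimately show ?thesis
        using emeasure_cball_aux[OF A(1), of "sqrt r"] True by (simp add: n_def)
    next
      case False
      have "{f. (\<Sum>i\<in>A. (f i)\<^sup>2) \<le> r} \<inter> space (PiM A (\<lambda>_. lborel :: real measure)) \<subseteq> Pi\<^sub>E A (\<lambda>_. {0})"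
      proof
        fix f assume f: "f \<in> {f. (\<Sum>i\<in>A. (f i)\<^sup>2) \<le> r} \<inter> space (PiM A (\<lambda>_. lborel :: real measure))"
        then have "(\<Sum>i\<in>A. (f i)\<^sup>2) = 0" using False by (intro antisym sum_nonneg) auto
        then have "\<forall>i\<in>A. f i = 0" using A by (simp add: sum_nonneg_eq_0_iff)
        then have "f \<in> Pi A (\<lambda>_. {0})" by simp
        then show "f \<in> Pi\<^sub>E A (\<lambda>_. {0})" unfolding PiE_def using f by (auto simp: space_PiM PiE_def)
      qed
      then have "emeasure (PiM A (\<lambda>_. lborel :: real measure))
          ({f. (\<Sum>i\<in>A. (f i)\<^sup>2) \<le> r} \<inter> space (PiM A (\<lambda>_. lborel)))
          \<le> emeasure (PiM A (\<lambda>_. lborel :: real measure)) (Pi\<^sub>E A (\<lambda>_. {0}))"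
        by (rule emeasure_mono) (rule sets_PiM_I_finite[OF A(1)], simp)
      also have "\<dots> = 0" using A by (subst L.emeasure_PiM) auto
      finally show ?thesis using False by simp
    qed
    finally show ?thesis .
  qed
  show "emeasure ?D {..real k} \<noteq> \<infinity>" for k by (simp add: D)
  fix S :: "real set" assume "S \<in> range atMost"
  then obtain r where S: "S = {..r}" by auto
  have "emeasure ?R {..r} = (\<integral>\<^sup>+s. ennreal (unit_ball_vol n * (n / 2) * (s powr (n / 2 - 1))) * indicator {0<..r} s \<partial>lborel)"
    by (subst emeasure_density) (auto intro!: nn_integral_cong simp: indicator_def)
  also have "\<dots> = ennreal (if r > 0 then unit_ball_vol n * r powr (n / 2) else 0)"
  proof (cases "r > 0")
    case True
    have "((\<lambda>s. s powr (n / 2 - 1)) has_integral (r powr (n / 2 - 1 + 1) / (n / 2 - 1 + 1))) {0..r}"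
      using n True by (intro has_integral_powr_from_0) auto
    then have "((\<lambda>s. unit_ball_vol n * (n / 2) * s powr (n / 2 - 1)) has_integral
        (unit_ball_vol n * (n / 2) * (r powr (n / 2 - 1 + 1) / (n / 2 - 1 + 1)))) {0..r}"
      by (rule has_integral_mult_right)
    then have hi: "((\<lambda>s. unit_ball_vol n * (n / 2) * s powr (n / 2 - 1)) has_integral (unit_ball_vol n * r powr (n / 2))) {0..r}"
      using n by simp
    have "(\<integral>\<^sup>+s. ennreal (unit_ball_vol n * (n / 2) * (s powr (n / 2 - 1))) * indicator {0<..r} s \<partial>lborel)
        = (\<integral>\<^sup>+s. ennreal (unit_ball_vol n * (n / 2) * (s powr (n / 2 - 1))) * indicator {0..r} s \<partial>lborel)"
      by (rule nn_integral_cong) (auto simp: indicator_def)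
    also have "\<dots> = ennreal (unit_ball_vol n * r powr (n / 2))"
      using n by (intro nn_integral_has_integral_lebesgue' hi) (auto simp: unit_ball_vol_nonneg)
    finally show ?thesis using True by simp
  qed (simp add: nn_integral_0_iff_AE)
  finally show "emeasure ?D S = emeasure ?R S" by (simp add: S D)
qed auto

lemma distr_std_normal_sum_squares:
  assumes A: "finite A" "A \<noteq> {}"
  shows "distr (PiM A (\<lambda>_. std_normal_distribution)) borel (\<lambda>f. \<Sum>i\<in>A. (f i)\<^sup>2)
    = density lborel (\<lambda>s. ennreal (chisq_density (real (card A)) s))"
proof -
  define n where "n = real (card A)"
  have n: "n > 0" using A by (simp add: n_def card_gt_0_iff)
  define g where "g s = ennreal ((2 * pi) powr (- n / 2) * exp (- s / 2))" for s
  have [measurable]: "g \<in> borel_measurable borel" unfolding g_def by measurable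
  have G: "(\<Prod>i\<in>A. ennreal (std_normal_density (f i))) = g (\<Sum>i\<in>A. (f i)\<^sup>2)" for f :: "'a \<Rightarrow> real"
  proof -
    have "(\<Prod>i\<in>A. std_normal_density (f i)) = (1 / sqrt (2 * pi)) ^ card A * exp (\<Sum>i\<in>A. - (f i)\<^sup>2 / 2)"
      using A by (simp add: std_normal_density_def prod.distrib exp_sum prod_dividef power_one_over)
    also have "(1 / sqrt (2 * pi)) ^ card A = (2 * pi) powr (- n / 2)"
      by (simp add: powr_half_sqrt[symmetric] powr_powr powr_realpow[symmetric] n_def powr_minus_divide powr_divide)
    also have "(\<Sum>i\<in>A. - (f i)\<^sup>2 / 2) = - (\<Sum>i\<in>A. (f i)\<^sup>2) / 2"
      by (simp add: sum_divide_distrib sum_negf)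
    finally show ?thesis by (simp add: prod_ennreal g_def)
  qed
  let ?T = "\<lambda>f. \<Sum>i\<in>A. (f i)\<^sup>2 :: real"
  let ?v = "\<lambda>s. ennreal (if 0 < s then unit_ball_vol n * (n / 2) * s powr (n / 2 - 1) else 0)"
  have "distr (PiM A (\<lambda>_. std_normal_distribution)) borel ?T
      = distr (density (PiM A (\<lambda>_. lborel)) (\<lambda>f. g (?T f))) borel ?T"
    by (simp add: PiM_std_normal_eq_density[OF A(1)] G)
  also have "\<dots> = density (distr (PiM A (\<lambda>_. lborel)) borel ?T) g"
    by (subst density_distr) simp_all
  also have "\<dots> = density (density lborel ?v) g"
    unfolding distr_lborel_sum_squares[OF A] n_def ..
  also have "\<dots> = density lborel (\<lambda>s. ?v s * g s)"
    by (rule density_density_eq) simp_all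
  also have "(\<lambda>s. ?v s * g s) = (\<lambda>s. ennreal (chisq_density n s))"
  proof
    fix s :: real
    have "Gamma ((n + 2) / 2) = n / 2 * Gamma (n / 2)"
      using Gamma_plus1[of "n / 2"] n by (simp add: add_divide_distrib nonpos_Ints_def)
    moreover have "Gamma (n / 2) > 0" using n by (simp add: Gamma_real_pos)
    ultimately have "unit_ball_vol n * (n / 2) * (2 * pi) powr (- n / 2) = 1 / (2 powr (n / 2) * Gamma (n / 2))"
      using n by (simp add: unit_ball_vol_def powr_mult powr_minus_divide field_simps)
    moreover have "unit_ball_vol n * (n / 2) * s powr (n / 2 - 1) * ((2 * pi) powr (- n / 2) * exp (- s / 2))
        = (unit_ball_vol n * (n / 2) * (2 * pi) powr (- n / 2)) * (s powr (n / 2 - 1) * exp (- s / 2))"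
      by (simp only: mult_ac)
    ultimately have "unit_ball_vol n * (n / 2) * s powr (n / 2 - 1) * ((2 * pi) powr (- n / 2) * exp (- s / 2))
        = s powr (n / 2 - 1) * exp (- s / 2) / (2 powr (n / 2) * Gamma (n / 2))"
      by simp
    then show "?v s * g s = ennreal (chisq_density n s)"
      using n by (auto simp: g_def chisq_density_def ennreal_mult[symmetric] unit_ball_vol_nonneg)
  qed
  finally show ?thesis by (simp add: n_def)
qed

section \<open>Joint law of residuals and mean\<close>

definition chisq_distribution :: "real \<Rightarrow> real measure" where
  "chisq_distribution \<nu> = density lborel (\<lambda>s. ennreal (chisq_density \<nu> s))"

lemma sets_chisq_distribution[simp, measurable_cong]: "sets (chisq_distribution \<nu>) = sets borel"
  by (simp add: chisq_distribution_def)

lemma prob_space_chisq_distribution: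
  assumes "0 < n"
  shows "prob_space (chisq_distribution (real n))"
proof -
  interpret N: prob_space std_normal_distribution by (rule prob_space_std_normal)
  interpret P: product_prob_space "\<lambda>_. std_normal_distribution" "{..<n}" by standard
  have "chisq_distribution (real n)
      = distr (PiM {..<n} (\<lambda>_. std_normal_distribution)) borel (\<lambda>f. \<Sum>i\<in>{..<n}. (f i)\<^sup>2)"
    using assms distr_std_normal_sum_squares[of "{..<n}"] lessThan_empty_iff[of n]
    by (simp add: chisq_distribution_def bot_nat_def)
  then show ?thesis by (simp add: P.prob_space_distr)
qed

context prob_space
begin

lemma iid_std_normal_residual_joint:
  fixes I :: "'i set" and K :: "'k set" and e :: "'k \<Rightarrow> 'i \<Rightarrow> real"
  assumes X: "iid_std_normal X I" and I: "finite I" and K: "finite K" and e: "orthonormal_on I K e"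
    and c: "(\<Sum>k\<in>K. (c k)\<^sup>2) = 1" and card: "card K < card I"
  defines "Y \<equiv> \<lambda>k \<omega>. \<Sum>i\<in>I. e k i * X i \<omega>"
  shows "distr M (borel \<Otimes>\<^sub>M borel)
      (\<lambda>\<omega>. ((\<Sum>i\<in>I. (X i \<omega>)\<^sup>2) - (\<Sum>k\<in>K. (Y k \<omega>)\<^sup>2), \<Sum>k\<in>K. c k * Y k \<omega>))
    = chisq_distribution (real (card I - card K)) \<Otimes>\<^sub>M std_normal_distribution"
proof -
  obtain Z \<kappa> where Z: "iid_std_normal Z I" and \<kappa>: "inj_on \<kappa> K" "\<kappa> ` K \<subseteq> I"
    and ZY: "\<And>k \<omega>. k \<in> K \<Longrightarrow> Z (\<kappa> k) \<omega> = Y k \<omega>"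
    and ZX: "\<And>\<omega>. (\<Sum>i\<in>I. (Z i \<omega>)\<^sup>2) = (\<Sum>i\<in>I. (X i \<omega>)\<^sup>2)"
    unfolding Y_def by (rule iid_std_normal_extend[OF K X I e]) blast
  define I1 where "I1 = \<kappa> ` K"
  define I2 where "I2 = I - I1"
  define d where "d i = c (the_inv_into K \<kappa> i)" for i
  have I12: "I1 \<subseteq> I" "I2 \<subseteq> I" "I1 \<inter> I2 = {}" "finite I1" "finite I2" "I = I1 \<union> I2"
    using \<kappa>(2) I finite_subset[OF \<kappa>(2) I] unfolding I1_def I2_def by blast+
  have cI2: "card I2 = card I - card K"
    unfolding I2_def using card_Diff_subset[OF I12(4,1)] card_image[OF \<kappa>(1)] by (simp add: I1_def)
  have C: "(\<Sum>i\<in>I. (X i \<omega>)\<^sup>2) - (\<Sum>k\<in>K. (Y k \<omega>)\<^sup>2) = (\<Sum>i\<in>I2. (Z i \<omega>)\<^sup>2)" for \<omega>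
  proof -
    have "(\<Sum>i\<in>I1. (Z i \<omega>)\<^sup>2) = (\<Sum>k\<in>K. (Y k \<omega>)\<^sup>2)"
      using \<kappa> ZY by (simp add: I1_def sum.reindex)
    moreover have "(\<Sum>i\<in>I. (Z i \<omega>)\<^sup>2) = (\<Sum>i\<in>I1. (Z i \<omega>)\<^sup>2) + (\<Sum>i\<in>I2. (Z i \<omega>)\<^sup>2)"
      using I12 by (subst I12(6)) (simp add: sum.union_disjoint)
    ultimately show ?thesis using ZX[of \<omega>] by simp
  qed
  have U: "(\<Sum>k\<in>K. c k * Y k \<omega>) = (\<Sum>i\<in>I1. d i * Z i \<omega>)" for \<omega>
    using \<kappa> ZY by (simp add: I1_def sum.reindex d_def the_inv_into_f_f)
  have d1: "(\<Sum>i\<in>I1. (d i)\<^sup>2) = 1"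
    using \<kappa> c by (simp add: I1_def sum.reindex d_def the_inv_into_f_f)
  have iv: "indep_vars (\<lambda>_. borel) Z I" using Z by (simp add: iid_std_normal_def)
  have "indep_var borel ((\<lambda>f. \<Sum>i\<in>I2. (f i)\<^sup>2) \<circ> (\<lambda>\<omega>. \<lambda>i\<in>I2. Z i \<omega>))
      borel ((\<lambda>f. \<Sum>i\<in>I1. d i * f i) \<circ> (\<lambda>\<omega>. \<lambda>i\<in>I1. Z i \<omega>))"
    using I12 by (intro indep_var_compose[OF indep_var_restrict[OF iv]]) auto
  then have "distr M (borel \<Otimes>\<^sub>M borel) (\<lambda>\<omega>. (\<Sum>i\<in>I2. (Z i \<omega>)\<^sup>2, \<Sum>i\<in>I1. d i * Z i \<omega>))
      = distr M borel (\<lambda>\<omega>. \<Sum>i\<in>I2. (Z i \<omega>)\<^sup>2) \<Otimes>\<^sub>M distr M borel (\<lambda>\<omega>. \<Sum>i\<in>I1. d i * Z i \<omega>)"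
    unfolding indep_var_distribution_eq by (simp add: o_def)
  also have "distr M borel (\<lambda>\<omega>. \<Sum>i\<in>I1. d i * Z i \<omega>) = std_normal_distribution"
    using I12 Z d1 by (intro iid_std_normal_linear) (auto intro: iid_std_normal_subset)
  also have "distr M borel (\<lambda>\<omega>. \<Sum>i\<in>I2. (Z i \<omega>)\<^sup>2) = chisq_distribution (real (card I - card K))"
  proof -
    have Z2: "iid_std_normal Z I2" using Z I12 by (auto intro: iid_std_normal_subset)
    have "I2 \<noteq> {}" using card cI2 by auto
    have [measurable]: "(\<lambda>\<omega>. \<lambda>i\<in>I2. Z i \<omega>) \<in> measurable M (PiM I2 (\<lambda>_. borel))"
      using Z2 by (intro measurable_restrict) (auto intro: iid_std_normal_measurable)
    have "distr M borel (\<lambda>\<omega>. \<Sum>i\<in>I2. (Z i \<omega>)\<^sup>2)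
        = distr M borel ((\<lambda>f. \<Sum>i\<in>I2. (f i)\<^sup>2) \<circ> (\<lambda>\<omega>. \<lambda>i\<in>I2. Z i \<omega>))"
      by (simp add: o_def)
    also have "\<dots> = distr (PiM I2 (\<lambda>_. std_normal_distribution)) borel (\<lambda>f. \<Sum>i\<in>I2. (f i)\<^sup>2)"
      by (subst iid_std_normal_distr_PiM[OF Z2 I12(5), symmetric], subst distr_distr) simp_all
    finally show ?thesis
      using distr_std_normal_sum_squares[OF I12(5) \<open>I2 \<noteq> {}\<close>] cI2 by (simp add: chisq_distribution_def)
  qed
  finally show ?thesis by (simp only: C U)
qed

lemma distr_pair_random_index:
  fixes C :: "'a \<Rightarrow> real" and U :: "nat \<Rightarrow> 'a \<Rightarrow> real"
  assumes Q: "prob_space Q" "sets Q = sets borel" and N: "prob_space N" "sets N = sets borel"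
    and C: "C \<in> borel_measurable M" and Um: "\<And>n. U n \<in> borel_measurable M"
    and \<tau>: "\<tau> \<in> borel \<rightarrow>\<^sub>M count_space UNIV"
    and U: "\<And>n. n \<in> range \<tau> \<Longrightarrow> distr M (borel \<Otimes>\<^sub>M borel) (\<lambda>\<omega>. (C \<omega>, U n \<omega>)) = Q \<Otimes>\<^sub>M N"
  shows "distr M (borel \<Otimes>\<^sub>M borel) (\<lambda>\<omega>. (C \<omega>, U (\<tau> (C \<omega>)) \<omega>)) = Q \<Otimes>\<^sub>M N"
proof -
  interpret Q: prob_space Q by fact
  interpret N: prob_space N by fact
  note [measurable] = C Um \<tau>
  have [measurable_cong]: "sets Q = sets borel" "sets N = sets borel" by fact+
  let ?D = "distr M (borel \<Otimes>\<^sub>M borel) (\<lambda>\<omega>. (C \<omega>, U (\<tau> (C \<omega>)) \<omega>))"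
  have [measurable]: "(\<lambda>\<omega>. U (\<tau> (C \<omega>)) \<omega>) \<in> borel_measurable M"
    by (rule measurable_compose_countable[where g="\<lambda>\<omega>. \<tau> (C \<omega>)" and f="\<lambda>n \<omega>. U n \<omega>"]) simp_all
  have "Q \<Otimes>\<^sub>M N = ?D"
  proof (rule pair_measure_eqI)
    fix A B assume "A \<in> sets Q" "B \<in> sets N"
    then have [measurable]: "A \<in> sets borel" "B \<in> sets borel" using Q N by auto
    define E where "E n = {\<omega> \<in> space M. C \<omega> \<in> A \<and> \<tau> (C \<omega>) = n \<and> U n \<omega> \<in> B}" for n
    define A' where "A' n = A \<inter> \<tau> -` {n}" for n
    have A'm[measurable]: "A' n \<in> sets borel" for n
      using measurable_sets[OF \<tau>, of "{n}"] by (auto simp: A'_def)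
    have [measurable]: "E n \<in> sets M" for n unfolding E_def by measurable
    have En: "emeasure M (E n) = emeasure Q (A' n) * emeasure N B" for n
    proof (cases "n \<in> range \<tau>")
      case True
      have "emeasure Q (A' n) * emeasure N B = emeasure (Q \<Otimes>\<^sub>M N) (A' n \<times> B)"
        using Q N by (subst N.emeasure_pair_measure_Times) auto
      also have "\<dots> = emeasure M ((\<lambda>\<omega>. (C \<omega>, U n \<omega>)) -` (A' n \<times> B) \<inter> space M)"
        by (subst U[OF True, symmetric], subst emeasure_distr) simp_all
      also have "(\<lambda>\<omega>. (C \<omega>, U n \<omega>)) -` (A' n \<times> B) \<inter> space M = E n"
        by (auto simp: E_def A'_def)
      finally show ?thesis ..
    next
      case False
      then have "E n = {}" "A' n = {}" by (auto simp: E_def A'_def)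
      then show ?thesis by simp
    qed
    have "(\<lambda>\<omega>. (C \<omega>, U (\<tau> (C \<omega>)) \<omega>)) -` (A \<times> B) \<inter> space M = (\<Union>n. E n)"
      by (auto simp: E_def)
    then have D: "emeasure ?D (A \<times> B) = emeasure M (\<Union>n. E n)"
      by (subst emeasure_distr) simp_all
    have "disjoint_family E" by (auto simp: disjoint_family_on_def E_def)
    then have sE: "(\<Sum>n. emeasure M (E n)) = emeasure M (\<Union>n. E n)"
      by (intro suminf_emeasure) auto
    have "disjoint_family A'" by (auto simp: disjoint_family_on_def A'_def)
    then have sA: "(\<Sum>n. emeasure Q (A' n)) = emeasure Q (\<Union>n. A' n)"
      by (intro suminf_emeasure) (auto simp: Q(2))
    have UA: "(\<Union>n. A' n) = A" by (auto simp: A'_def)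
    show "emeasure Q A * emeasure N B = emeasure ?D (A \<times> B)"
      unfolding D sE[symmetric] En ennreal_suminf_multc sA UA ..
  qed (auto intro: Q.sigma_finite_measure N.sigma_finite_measure simp: Q N cong: sets_pair_measure_cong)
  then show ?thesis ..
qed

end

lemma (in prob_space) integrable_unit_interval:
  fixes f :: "'a \<Rightarrow> real"
  assumes "f \<in> borel_measurable M" "\<And>x. 0 \<le> f x" "\<And>x. f x \<le> 1"
  shows "integrable M f"
  using assms by (intro integrable_const_bound[where B=1]) auto

text \<open>Integrate \<open>(f x - f y) * (g x - g y) \<ge> 0\<close>.\<close>

lemma association_inequality:
  fixes f g :: "real \<Rightarrow> real" and P :: "real measure"
  assumes P: "prob_space P" "sets P = sets borel"
    and f: "mono f" "\<And>x. 0 \<le> f x" "\<And>x. f x \<le> 1"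
    and g: "mono g" "\<And>x. 0 \<le> g x" "\<And>x. g x \<le> 1"
  shows "(\<integral>x. f x \<partial>P) * (\<integral>x. g x \<partial>P) \<le> (\<integral>x. f x * g x \<partial>P)"
proof -
  interpret P: prob_space P by fact
  have [measurable]: "f \<in> borel_measurable P" "g \<in> borel_measurable P"
    using borel_measurable_mono f(1) g(1) P(2) by (auto cong: measurable_cong_sets)
  have fg01: "0 \<le> f x * g x" "f x * g x \<le> 1" for x using f g by (auto intro: mult_le_one)
  have [simp]: "integrable P f" "integrable P g" "integrable P (\<lambda>x. f x * g x)"
    using f g fg01 by (auto intro!: P.integrable_unit_interval)
  let ?f = "\<integral>x. f x \<partial>P" and ?g = "\<integral>x. g x \<partial>P" and ?fg = "\<integral>x. f x * g x \<partial>P"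
  have "0 \<le> ?fg - f y * ?g - ?f * g y + f y * g y" for y
  proof -
    have "0 \<le> (\<integral>x. (f x - f y) * (g x - g y) \<partial>P)"
    proof (rule integral_nonneg_AE, rule AE_I2)
      fix x show "0 \<le> (f x - f y) * (g x - g y)"
        using monoD[OF f(1), of x y] monoD[OF g(1), of x y] monoD[OF f(1), of y x] monoD[OF g(1), of y x]
        by (cases "x \<le> y") (auto intro: mult_nonneg_nonneg mult_nonpos_nonpos)
    qed
    also have "(\<integral>x. (f x - f y) * (g x - g y) \<partial>P) = (\<integral>x. f x * g x - f y * g x - f x * g y + f y * g y \<partial>P)"
      by (intro Bochner_Integration.integral_cong) (auto simp: algebra_simps)
    also have "\<dots> = ?fg - f y * ?g - ?f * g y + f y * g y"
      using P.prob_space by simp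
    finally show ?thesis .
  qed
  then have "0 \<le> (\<integral>y. ?fg - f y * ?g - ?f * g y + f y * g y \<partial>P)"
    by (intro integral_nonneg_AE AE_I2)
  also have "\<dots> = ?fg - ?f * ?g - ?f * ?g + ?fg"
    using P.prob_space by simp
  finally show ?thesis by simp
qed

lemma association_inequality_prod:
  fixes f :: "'i \<Rightarrow> real \<Rightarrow> real" and P :: "real measure"
  assumes P: "prob_space P" "sets P = sets borel" and J: "finite J"
    and f: "\<And>j. j \<in> J \<Longrightarrow> mono (f j)" "\<And>j x. j \<in> J \<Longrightarrow> 0 \<le> f j x" "\<And>j x. j \<in> J \<Longrightarrow> f j x \<le> 1"
  shows "(\<Prod>j\<in>J. \<integral>x. f j x \<partial>P) \<le> (\<integral>x. (\<Prod>j\<in>J. f j x) \<partial>P)"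
  using J f
proof (induction J rule: finite_induct)
  case empty
  interpret P: prob_space P by fact
  show ?case by (simp add: P.prob_space)
next
  case (insert i J)
  have "(\<Prod>j\<in>insert i J. \<integral>x. f j x \<partial>P) = (\<integral>x. f i x \<partial>P) * (\<Prod>j\<in>J. \<integral>x. f j x \<partial>P)"
    using insert by simp
  also have "\<dots> \<le> (\<integral>x. f i x \<partial>P) * (\<integral>x. (\<Prod>j\<in>J. f j x) \<partial>P)"
    using insert by (intro mult_left_mono insert.IH integral_nonneg_AE AE_I2) auto
  also have "\<dots> \<le> (\<integral>x. f i x * (\<Prod>j\<in>J. f j x) \<partial>P)"
  proof (rule association_inequality[OF P])
    show "mono (\<lambda>x. \<Prod>j\<in>J. f j x)"
      using insert.prems by (intro monoI prod_mono) (auto dest: monoD)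
    show "0 \<le> (\<Prod>j\<in>J. f j x)" "(\<Prod>j\<in>J. f j x) \<le> 1" for x
      using insert.prems by (auto intro: prod_nonneg prod_le_1)
  qed (use insert.prems in auto)
  also have "\<dots> = (\<integral>x. (\<Prod>j\<in>insert i J. f j x) \<partial>P)" using insert by simp
  finally show ?case .
qed

lemma std_normal_singleton_null: "emeasure std_normal_distribution {x} = 0"
  by (subst emeasure_density) (auto intro!: nn_integral_null_set)

lemma mono_std_normal_cdf: "mono std_normal_cdf"
proof -
  interpret N: prob_space std_normal_distribution by (rule prob_space_std_normal)
  show ?thesis unfolding std_normal_cdf_def by (intro monoI N.finite_measure_mono) auto
qed

lemma borel_measurable_std_normal_cdf[measurable]: "std_normal_cdf \<in> borel_measurable borel"
  by (rule borel_measurable_mono[OF mono_std_normal_cdf])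

lemma std_normal_cdf_nonneg: "0 \<le> std_normal_cdf z"
  by (simp add: std_normal_cdf_def)

lemma std_normal_cdf_le_1: "std_normal_cdf z \<le> 1"
proof -
  interpret N: prob_space std_normal_distribution by (rule prob_space_std_normal)
  show ?thesis by (simp add: std_normal_cdf_def)
qed

lemma emeasure_std_normal_prod_halfplane:
  fixes a b \<delta> :: real
  assumes a: "a > 0" and b: "b > 0"
  shows "emeasure (std_normal_distribution \<Otimes>\<^sub>M std_normal_distribution) {(x, y). a * x < b * y + \<delta>}
    = ennreal (std_normal_cdf (\<delta> / sqrt (a\<^sup>2 + b\<^sup>2)))"
proof -
  interpret N: prob_space std_normal_distribution by (rule prob_space_std_normal)
  let ?N = std_normal_distribution
  define r where "r = sqrt (a\<^sup>2 + b\<^sup>2)"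
  have r: "r > 0" using a by (auto simp: r_def sum_power2_gt_zero_iff)
  have r2: "a\<^sup>2 + b\<^sup>2 = r\<^sup>2" by (simp add: r_def)
  define c where "c = a / r"
  define s where "s = - b / r"
  have cs: "c\<^sup>2 + s\<^sup>2 = 1" using r by (simp add: c_def s_def power_divide add_divide_distrib[symmetric] r2)
  have s: "s \<noteq> 0" using b r by (simp add: s_def)
  let ?R = "\<lambda>(x, y). (c * x + s * y, c * y - s * x)"
  have "(a * x < b * y + \<delta>) = (c * x + s * y < \<delta> / r)" for x y
  proof -
    have "c * x + s * y = (a * x - b * y) / r" by (simp add: c_def s_def diff_divide_distrib)
    then show ?thesis using r by (simp add: divide_less_cancel) linarith
  qed
  then have "{(x, y). a * x < b * y + \<delta>} = ?R -` ({..<\<delta> / r} \<times> UNIV) \<inter> space (?N \<Otimes>\<^sub>M ?N)"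
    by (auto simp: space_pair_measure)
  then have "emeasure (?N \<Otimes>\<^sub>M ?N) {(x, y). a * x < b * y + \<delta>}
      = emeasure (distr (?N \<Otimes>\<^sub>M ?N) (borel \<Otimes>\<^sub>M borel) ?R) ({..<\<delta> / r} \<times> UNIV)"
    by (subst emeasure_distr) simp_all
  also have "\<dots> = emeasure ?N {..<\<delta> / r} * emeasure ?N UNIV"
    by (simp only: distr_std_normal_prod_rotation[OF cs s]) (simp add: N.emeasure_pair_measure_Times)
  also have "emeasure ?N UNIV = 1" using N.emeasure_space_1 by simp
  also have "emeasure ?N {..<\<delta> / r} = emeasure ?N {..\<delta> / r}"
  proof -
    have "{..\<delta> / r} = {..<\<delta> / r} \<union> {\<delta> / r}" by auto
    moreover have "{\<delta> / r} \<in> null_sets ?N" by (intro null_setsI std_normal_singleton_null) simp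
    ultimately show ?thesis using emeasure_Un_null_set[of "{..<\<delta> / r}" ?N "{\<delta> / r}"] by simp
  qed
  finally show ?thesis by (simp add: std_normal_cdf_def N.emeasure_eq_measure r_def)
qed

section \<open>Probability of simultaneous comparisons\<close>

lemma nn_integral_halfplane_prob:
  fixes \<alpha> :: "real \<Rightarrow> real" and b \<delta> :: real
  assumes Q: "prob_space Q" "sets Q = sets borel" and \<alpha>: "\<alpha> \<in> borel_measurable borel"
    and pos: "\<And>s. 0 < \<alpha> s" "0 < b"
  shows "(\<integral>\<^sup>+w. emeasure (Q \<Otimes>\<^sub>M std_normal_distribution) {z. \<alpha> (fst z) * snd z < b * w + \<delta>} \<partial>std_normal_distribution)
    = (\<integral>\<^sup>+s. ennreal (std_normal_cdf (\<delta> / sqrt ((\<alpha> s)\<^sup>2 + b\<^sup>2))) \<partial>Q)"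
proof -
  let ?N = std_normal_distribution
  interpret N: prob_space ?N by (rule prob_space_std_normal)
  interpret Q: prob_space Q by fact
  interpret QN: pair_sigma_finite Q ?N ..
  interpret NN: pair_sigma_finite ?N ?N ..
  note [measurable] = \<alpha>
  have [measurable_cong]: "sets Q = sets borel" by fact
  have spQ: "space Q = UNIV" using Q(2) sets_eq_imp_space_eq by fastforce
  define u where "u s x w = (indicator {z. \<alpha> (fst z) * snd z < b * w + \<delta>} (s, x) :: ennreal)" for s x w
  have "(\<integral>\<^sup>+w. emeasure (Q \<Otimes>\<^sub>M ?N) {z. \<alpha> (fst z) * snd z < b * w + \<delta>} \<partial>?N)
      = (\<integral>\<^sup>+w. (\<integral>\<^sup>+s. (\<integral>\<^sup>+x. u s x w \<partial>?N) \<partial>Q) \<partial>?N)"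
  proof (rule nn_integral_cong)
    fix w
    have "{z \<in> space (Q \<Otimes>\<^sub>M ?N). \<alpha> (fst z) * snd z < b * w + \<delta>} \<in> sets (Q \<Otimes>\<^sub>M ?N)" by measurable
    then have S: "{z. \<alpha> (fst z) * snd z < b * w + \<delta>} \<in> sets (Q \<Otimes>\<^sub>M ?N)"
      by (simp add: space_pair_measure spQ)
    have "emeasure (Q \<Otimes>\<^sub>M ?N) {z. \<alpha> (fst z) * snd z < b * w + \<delta>}
        = (\<integral>\<^sup>+s. (\<integral>\<^sup>+x. indicator {z. \<alpha> (fst z) * snd z < b * w + \<delta>} (s, x) \<partial>?N) \<partial>Q)"
      by (rule N.emeasure_pair_measure[OF S])
    then show "emeasure (Q \<Otimes>\<^sub>M ?N) {z. \<alpha> (fst z) * snd z < b * w + \<delta>}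
        = (\<integral>\<^sup>+s. (\<integral>\<^sup>+x. u s x w \<partial>?N) \<partial>Q)" by (simp add: u_def)
  qed
  also have "\<dots> = (\<integral>\<^sup>+s. (\<integral>\<^sup>+w. (\<integral>\<^sup>+x. u s x w \<partial>?N) \<partial>?N) \<partial>Q)"
    by (rule QN.Fubini') (unfold u_def indicator_def, measurable)
  also have "\<dots> = (\<integral>\<^sup>+s. ennreal (std_normal_cdf (\<delta> / sqrt ((\<alpha> s)\<^sup>2 + b\<^sup>2))) \<partial>Q)"
  proof (rule nn_integral_cong)
    fix s
    have "{z \<in> space (?N \<Otimes>\<^sub>M ?N). \<alpha> s * fst z < b * snd z + \<delta>} \<in> sets (?N \<Otimes>\<^sub>M ?N)" by measurable
    then have S: "{(x, y). \<alpha> s * x < b * y + \<delta>} \<in> sets (?N \<Otimes>\<^sub>M ?N)"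
      by (simp add: space_pair_measure case_prod_beta')
    have "(\<integral>\<^sup>+w. (\<integral>\<^sup>+x. u s x w \<partial>?N) \<partial>?N)
        = (\<integral>\<^sup>+w. (\<integral>\<^sup>+x. indicator {(x, y). \<alpha> s * x < b * y + \<delta>} (x, w) \<partial>?N) \<partial>?N)"
      by (simp add: u_def indicator_def)
    also have "\<dots> = (\<integral>\<^sup>+z. indicator {(x, y). \<alpha> s * x < b * y + \<delta>} z \<partial>(?N \<Otimes>\<^sub>M ?N))"
      by (rule NN.nn_integral_snd) (rule borel_measurable_indicator[OF S])
    also have "\<dots> = emeasure (?N \<Otimes>\<^sub>M ?N) {(x, y). \<alpha> s * x < b * y + \<delta>}"
      by (rule nn_integral_indicator[OF S])
    finally show "(\<integral>\<^sup>+w. (\<integral>\<^sup>+x. u s x w \<partial>?N) \<partial>?N) = ennreal (std_normal_cdf (\<delta> / sqrt ((\<alpha> s)\<^sup>2 + b\<^sup>2)))"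
      by (simp only: emeasure_std_normal_prod_halfplane[OF pos(1) pos(2)])
  qed
  finally show ?thesis .
qed

text \<open>Conditionally on the pair of \<open>i0\<close> the comparisons are independent, and each of their
  probabilities is monotone in the normal component of \<open>i0\<close>, so that they are positively associated.\<close>

lemma selection_bound_PiM:
  fixes a :: "'i \<Rightarrow> real \<Rightarrow> real" and \<delta> :: real and Q :: "real measure"
  assumes Q: "prob_space Q" "sets Q = sets borel" and J: "finite J" "i0 \<notin> J"
    and a: "\<And>i. a i \<in> borel_measurable borel" and pos: "\<And>i s. i \<in> insert i0 J \<Longrightarrow> 0 < a i s"
  defines "P \<equiv> PiM (insert i0 J) (\<lambda>_. Q \<Otimes>\<^sub>M std_normal_distribution)"
  shows "(\<integral>\<^sup>+t. (\<Prod>j\<in>J. \<integral>\<^sup>+s. ennreal (std_normal_cdf (\<delta> / sqrt ((a j s)\<^sup>2 + (a i0 t)\<^sup>2))) \<partial>Q) \<partial>Q)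
    \<le> emeasure P {p \<in> space P. \<forall>j\<in>J. a j (fst (p j)) * snd (p j) < a i0 (fst (p i0)) * snd (p i0) + \<delta>}"
    (is "_ \<le> emeasure P ?E")
proof -
  let ?N = std_normal_distribution
  interpret N: prob_space ?N by (rule prob_space_std_normal)
  interpret Q: prob_space Q by fact
  define R where "R = Q \<Otimes>\<^sub>M ?N"
  interpret QN: pair_prob_space Q ?N ..
  interpret R: prob_space R unfolding R_def by (rule QN.prob_space_axioms)
  interpret PR: product_sigma_finite "\<lambda>_::'i. R"
    by (simp add: product_sigma_finite_def R.sigma_finite_measure_axioms)
  note [measurable] = a
  have [measurable_cong]: "sets Q = sets borel" by fact
  have [measurable_cong]: "sets R = sets (borel \<Otimes>\<^sub>M borel)"
    unfolding R_def using Q(2) by (auto cong: sets_pair_measure_cong)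
  have spR: "space R = UNIV"
    using sets_eq_imp_space_eq[OF \<open>sets R = _\<close>] by (simp add: space_pair_measure)
  have P: "P = PiM (insert i0 J) (\<lambda>_. R)" by (simp add: P_def R_def)
  define H where "H j t w = {z. a j (fst z) * snd z < a i0 t * w + \<delta>}" for j t w
  have Hm[measurable]: "H j t w \<in> sets R" for j t w
  proof -
    have "{z \<in> space R. a j (fst z) * snd z < a i0 t * w + \<delta>} \<in> sets R" by measurable
    then show ?thesis by (simp add: H_def spR)
  qed
  define g where "g j t w = measure R (H j t w)" for j t w
  have g01: "0 \<le> g j t w" "g j t w \<le> 1" for j t w by (auto simp: g_def)
  have gmono: "mono (g j t)" for j t
  proof (rule monoI)
    fix w w' :: real assume w: "w \<le> w'"
    have "a i0 t * w \<le> a i0 t * w'" using pos[of i0 t] w by (intro mult_left_mono) auto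
    then have "H j t w \<subseteq> H j t w'" by (auto simp: H_def)
    then show "g j t w \<le> g j t w'" unfolding g_def by (intro R.finite_measure_mono) auto
  qed
  have gm: "g j t \<in> borel_measurable borel" for j t by (rule borel_measurable_mono[OF gmono])
  have Em: "?E \<in> sets P" unfolding P using J by measurable
  have inner: "(\<integral>\<^sup>+x. indicator ?E (x(i0 := (t, w))) \<partial>PiM J (\<lambda>_. R)) = ennreal (\<Prod>j\<in>J. g j t w)" for t w
  proof -
    have "(\<integral>\<^sup>+x. indicator ?E (x(i0 := (t, w))) \<partial>PiM J (\<lambda>_. R))
        = (\<integral>\<^sup>+x. indicator (Pi\<^sub>E J (\<lambda>j. H j t w)) x \<partial>PiM J (\<lambda>_. R))"
    proof (rule nn_integral_cong)
      fix x assume x: "x \<in> space (PiM J (\<lambda>_. R))"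
      then have "x(i0 := (t, w)) \<in> space P"
        by (auto simp: P space_PiM spR PiE_iff extensional_def)
      moreover have "(\<forall>j\<in>J. a j (fst ((x(i0 := (t, w))) j)) * snd ((x(i0 := (t, w))) j)
          < a i0 (fst ((x(i0 := (t, w))) i0)) * snd ((x(i0 := (t, w))) i0) + \<delta>)
          \<longleftrightarrow> (\<forall>j\<in>J. x j \<in> H j t w)"
        using J(2) by (auto simp: H_def)
      moreover have "x \<in> Pi\<^sub>E J (\<lambda>j. H j t w) \<longleftrightarrow> (\<forall>j\<in>J. x j \<in> H j t w)"
        using x by (simp add: space_PiM PiE_iff)
      ultimately show "indicator ?E (x(i0 := (t, w))) = (indicator (Pi\<^sub>E J (\<lambda>j. H j t w)) x :: ennreal)"
        by (simp add: indicator_def)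
    qed
    also have "\<dots> = emeasure (PiM J (\<lambda>_. R)) (Pi\<^sub>E J (\<lambda>j. H j t w))"
      using J by (intro nn_integral_indicator sets_PiM_I_finite) auto
    also have "\<dots> = (\<Prod>j\<in>J. emeasure R (H j t w))" using J by (intro PR.emeasure_PiM) auto
    also have "\<dots> = ennreal (\<Prod>j\<in>J. g j t w)"
      by (simp add: R.emeasure_eq_measure g_def prod_ennreal)
    finally show ?thesis .
  qed
  have E: "emeasure P ?E = (\<integral>\<^sup>+t. (\<integral>\<^sup>+w. ennreal (\<Prod>j\<in>J. g j t w) \<partial>?N) \<partial>Q)"
  proof -
    have im: "indicator ?E \<in> borel_measurable (PiM (insert i0 J) (\<lambda>_. R))"
      using Em unfolding P by measurable
    have ym: "(\<lambda>y. \<integral>\<^sup>+x. indicator ?E (x(i0 := y)) \<partial>PiM J (\<lambda>_. R)) \<in> borel_measurable R"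
    proof -
      interpret PJ: sigma_finite_measure "PiM J (\<lambda>_. R)" using J PR.sigma_finite by blast
      have "(\<lambda>(y, x). x(i0 := y)) \<in> R \<Otimes>\<^sub>M PiM J (\<lambda>_. R) \<rightarrow>\<^sub>M PiM (insert i0 J) (\<lambda>_. R)"
        by measurable
      from measurable_compose[OF this im] show ?thesis
        by (intro PJ.borel_measurable_nn_integral) (simp add: case_prod_beta')
    qed
    have "emeasure P ?E = (\<integral>\<^sup>+p. indicator ?E p \<partial>P)" using Em by simp
    also have "\<dots> = (\<integral>\<^sup>+y. (\<integral>\<^sup>+x. indicator ?E (x(i0 := y)) \<partial>PiM J (\<lambda>_. R)) \<partial>R)"
      unfolding P by (rule PR.product_nn_integral_insert_rev[OF J im[unfolded P]])
    also have "\<dots> = (\<integral>\<^sup>+t. (\<integral>\<^sup>+w. (\<integral>\<^sup>+x. indicator ?E (x(i0 := (t, w))) \<partial>PiM J (\<lambda>_. R)) \<partial>?N) \<partial>Q)"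
      unfolding R_def by (rule N.nn_integral_fst[symmetric]) (use ym in \<open>simp add: R_def\<close>)
    finally show ?thesis by (simp only: inner)
  qed
  show ?thesis unfolding E
  proof (rule nn_integral_mono)
    fix t
    have "(\<Prod>j\<in>J. \<integral>\<^sup>+s. ennreal (std_normal_cdf (\<delta> / sqrt ((a j s)\<^sup>2 + (a i0 t)\<^sup>2))) \<partial>Q)
        = (\<Prod>j\<in>J. \<integral>\<^sup>+w. ennreal (g j t w) \<partial>?N)"
    proof (rule prod.cong[OF refl])
      fix j assume j: "j \<in> J"
      have "(\<integral>\<^sup>+w. ennreal (g j t w) \<partial>?N) = (\<integral>\<^sup>+w. emeasure R (H j t w) \<partial>?N)"
        by (simp add: g_def R.emeasure_eq_measure)
      also have "\<dots> = (\<integral>\<^sup>+s. ennreal (std_normal_cdf (\<delta> / sqrt ((a j s)\<^sup>2 + (a i0 t)\<^sup>2))) \<partial>Q)"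
        unfolding R_def H_def using j pos by (intro nn_integral_halfplane_prob Q) auto
      finally show "(\<integral>\<^sup>+s. ennreal (std_normal_cdf (\<delta> / sqrt ((a j s)\<^sup>2 + (a i0 t)\<^sup>2))) \<partial>Q)
          = (\<integral>\<^sup>+w. ennreal (g j t w) \<partial>?N)" ..
    qed
    also have "\<dots> = (\<Prod>j\<in>J. ennreal (\<integral>w. g j t w \<partial>?N))"
      using g01 gm by (intro prod.cong refl nn_integral_eq_integral N.integrable_unit_interval) auto
    also have "\<dots> = ennreal (\<Prod>j\<in>J. \<integral>w. g j t w \<partial>?N)"
      using g01 by (intro prod_ennreal) auto
    also have "\<dots> \<le> ennreal (\<integral>w. (\<Prod>j\<in>J. g j t w) \<partial>?N)"
      using g01 gmono J by (intro ennreal_leI association_inequality_prod N.prob_space_axioms) auto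
    also have "\<dots> = (\<integral>\<^sup>+w. ennreal (\<Prod>j\<in>J. g j t w) \<partial>?N)"
    proof (rule nn_integral_eq_integral[symmetric])
      have [measurable]: "\<And>j. g j t \<in> borel_measurable borel" by (rule gm)
      show "integrable ?N (\<lambda>w. \<Prod>j\<in>J. g j t w)"
        using g01 by (intro N.integrable_unit_interval) (auto intro: prod_nonneg prod_le_1)
    qed (intro AE_I2 prod_nonneg ballI g01)
    finally show "(\<Prod>j\<in>J. \<integral>\<^sup>+s. ennreal (std_normal_cdf (\<delta> / sqrt ((a j s)\<^sup>2 + (a i0 t)\<^sup>2))) \<partial>Q)
        \<le> (\<integral>\<^sup>+w. ennreal (\<Prod>j\<in>J. g j t w) \<partial>?N)" .
  qed
qed

section \<open>Least squares\<close>

locale full_rank_design =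
  fixes X :: "real^'p::finite^'m::finite"
  assumes inv: "invertible (transpose X ** X)"
begin

definition "Ginv = matrix_inv (transpose X ** X)"

definition "lever x = X *v (transpose Ginv *v x)"

lemma Ginv_left: "Ginv ** (transpose X ** X) = mat 1" and Ginv_right: "(transpose X ** X) ** Ginv = mat 1"
proof -
  have "\<exists>B. (transpose X ** X) ** B = mat 1 \<and> B ** (transpose X ** X) = mat 1"
    using inv by (simp add: invertible_def)
  from someI_ex[OF this] show "Ginv ** (transpose X ** X) = mat 1" "(transpose X ** X) ** Ginv = mat 1"
    by (simp_all add: Ginv_def matrix_inv_def)
qed

lemma inner_matrix_transpose: "x \<bullet> (A *v y) = (transpose A *v x) \<bullet> y" for A :: "real^'b::finite^'c::finite"
  by (simp add: dot_lmul_matrix)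

lemma gram_transpose_Ginv: "(transpose X ** X) ** transpose Ginv = mat 1"
proof -
  have "transpose (Ginv ** (transpose X ** X)) = transpose (mat 1 :: real^'p^'p)" by (simp only: Ginv_left)
  then show ?thesis by (simp add: matrix_transpose_mul transpose_mat matrix_mul_assoc)
qed

lemma inj_design: "inj ((*v) X)"
proof (rule injI)
  fix c d assume "X *v c = X *v d"
  then have "transpose X *v (X *v c) = transpose X *v (X *v d)" by simp
  then have "Ginv *v ((transpose X ** X) *v c) = Ginv *v ((transpose X ** X) *v d)"
    by (simp add: matrix_vector_mul_assoc)
  then show "c = d" by (simp add: matrix_vector_mul_assoc matrix_mul_assoc[symmetric] Ginv_left)
qed

lemma dim_range_design: "dim (range ((*v) X)) = CARD('p)"
proof -
  have "dim ((*v) X ` UNIV) = dim (UNIV :: (real^'p) set)"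
    by (rule dim_image_eq[OF matrix_vector_mul_linear]) (use inj_design in \<open>simp add: inj_on_def inj_def\<close>)
  then show ?thesis by simp
qed

lemma card_le: "CARD('p) \<le> CARD('m)"
  using dim_subset_UNIV[of "range ((*v) X)"] dim_range_design by simp

lemma inner_lever: "x \<bullet> ((Ginv ** transpose X) *v y) = lever x \<bullet> y"
  unfolding lever_def matrix_vector_mul_assoc[symmetric]
  by (simp only: inner_matrix_transpose transpose_transpose)

lemma transpose_design_lever: "transpose X *v lever x = x"
  unfolding lever_def matrix_vector_mul_assoc matrix_mul_assoc gram_transpose_Ginv by simp

lemma lever_sq: "lever x \<bullet> lever x = x \<bullet> (Ginv *v x)"
proof -
  have "lever x \<bullet> lever x = (transpose X *v lever x) \<bullet> (transpose Ginv *v x)"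
    by (subst (2) lever_def) (rule inner_matrix_transpose)
  also have "\<dots> = x \<bullet> (transpose Ginv *v x)" by (simp only: transpose_design_lever)
  also have "\<dots> = x \<bullet> (Ginv *v x)"
    by (metis inner_matrix_transpose inner_commute)
  finally show ?thesis .
qed

lemma lever_eq_0_iff: "lever x = 0 \<longleftrightarrow> x = 0"
proof
  assume "lever x = 0"
  then show "x = 0" using transpose_design_lever[of x] by simp
qed (simp add: lever_def)

lemma lever_in_range: "lever x \<in> range ((*v) X)" by (simp add: lever_def)

lemma ols_linear_model:
  assumes "0 < n"
  shows "ols X n (\<lambda>l. X *v b + \<epsilon> l) = b + (1 / real n) *\<^sub>R ((Ginv ** transpose X) *v (\<Sum>l<n. \<epsilon> l))"
proof -
  have "(Ginv ** transpose X) *v (X *v b) = b"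
    by (simp add: matrix_vector_mul_assoc matrix_mul_assoc[symmetric] Ginv_left)
  then show ?thesis
    using assms unfolding ols_def Ginv_def[symmetric]
    by (simp add: sum.distrib matrix_vector_right_distrib scaleR_right_distrib sum_constant_scaleR
        matrix_vector_mult_scaleR del: sum_constant)
qed

definition "hat y = X *v ((Ginv ** transpose X) *v y)"

lemma inner_range_hat: "v \<in> range ((*v) X) \<Longrightarrow> v \<bullet> hat y = v \<bullet> y"
proof -
  assume "v \<in> range ((*v) X)"
  then obtain c where v: "v = X *v c" by auto
  have "transpose X *v hat y = transpose X *v y"
    unfolding hat_def by (simp add: matrix_vector_mul_assoc matrix_mul_assoc Ginv_right)
  then show ?thesis unfolding v
    by (metis inner_matrix_transpose inner_commute)
qed

lemma residual_sum_of_squares: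
  assumes n0: "0 < n0"
    and B: "B \<subseteq> range ((*v) X)" "pairwise orthogonal B" "\<And>v. v \<in> B \<Longrightarrow> norm v = 1" "span B = range ((*v) X)"
  shows "(\<Sum>l<n0. (X *v b + \<epsilon> l - X *v ols X n0 (\<lambda>l. X *v b + \<epsilon> l)) \<bullet> (X *v b + \<epsilon> l - X *v ols X n0 (\<lambda>l. X *v b + \<epsilon> l)))
    = (\<Sum>l<n0. \<epsilon> l \<bullet> \<epsilon> l) - (\<Sum>v\<in>B. (v \<bullet> (\<Sum>l<n0. \<epsilon> l))\<^sup>2) / real n0"
proof -
  define s where "s = (\<Sum>l<n0. \<epsilon> l)"
  define H where "H = (1 / real n0) *\<^sub>R hat s"
  have res: "X *v b + \<epsilon> l - X *v ols X n0 (\<lambda>l. X *v b + \<epsilon> l) = \<epsilon> l - H" for l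
    unfolding ols_linear_model[OF n0] s_def[symmetric]
    by (simp add: matrix_vector_right_distrib H_def hat_def matrix_vector_mult_scaleR)
  have hs: "hat s \<in> range ((*v) X)" by (simp add: hat_def)
  have hh: "hat s \<bullet> s = hat s \<bullet> hat s" using inner_range_hat[OF hs, of s] by simp
  have fB: "finite B" using B(2,3) by (metis norm_zero pairwise_orthogonal_imp_finite zero_neq_one)
  have ex: "(\<Sum>v\<in>B. (hat s \<bullet> v) *\<^sub>R v) = hat s"
    using orthonormal_basis_expand[OF B(2,3) _ fB, of "hat s"] hs B(4) by simp
  have "hat s \<bullet> hat s = hat s \<bullet> (\<Sum>v\<in>B. (hat s \<bullet> v) *\<^sub>R v)" by (simp only: ex)
  also have "\<dots> = (\<Sum>v\<in>B. (v \<bullet> hat s)\<^sup>2)" by (simp add: inner_sum_right power2_eq_square inner_commute)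
  also have "\<dots> = (\<Sum>v\<in>B. (v \<bullet> s)\<^sup>2)" using B(1) inner_range_hat by (intro sum.cong) auto
  finally have par: "hat s \<bullet> hat s = (\<Sum>v\<in>B. (v \<bullet> s)\<^sup>2)" .
  have "(\<Sum>l<n0. (\<epsilon> l - H) \<bullet> (\<epsilon> l - H)) = (\<Sum>l<n0. \<epsilon> l \<bullet> \<epsilon> l - 2 * (\<epsilon> l \<bullet> H) + H \<bullet> H)"
    by (intro sum.cong) (auto simp: inner_diff_left inner_diff_right inner_commute)
  also have "\<dots> = (\<Sum>l<n0. \<epsilon> l \<bullet> \<epsilon> l) - 2 * (s \<bullet> H) + real n0 * (H \<bullet> H)"
    by (simp add: sum.distrib sum_subtractf s_def inner_sum_left sum_distrib_left)
  also have "s \<bullet> H = (hat s \<bullet> hat s) / real n0"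
    using hh by (simp add: H_def inner_commute)
  also have "real n0 * (H \<bullet> H) = (hat s \<bullet> hat s) / real n0" using n0 by (simp add: H_def)
  finally show ?thesis unfolding res s_def[symmetric] par by simp
qed

end

section \<open>Two-stage statistics\<close>

definition rss_stat :: "nat \<Rightarrow> (real^'m::finite) set \<Rightarrow> (nat \<Rightarrow> real^'m) \<Rightarrow> real" where
  "rss_stat n0 B e = (\<Sum>l<n0. e l \<bullet> e l) - (\<Sum>v\<in>B. (v \<bullet> (\<Sum>l<n0. e l))\<^sup>2) / real n0"

definition mean_stat :: "real^'m::finite \<Rightarrow> nat \<Rightarrow> (nat \<Rightarrow> real^'m) \<Rightarrow> real" where
  "mean_stat a n e = (\<Sum>l<n. a \<bullet> e l) / sqrt (real n * (a \<bullet> a))"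

lemma sum_head_block:
  fixes f :: "nat \<Rightarrow> 'm::finite \<Rightarrow> real"
  assumes "n0 \<le> n"
  shows "(\<Sum>i\<in>{..<n} \<times> UNIV. case i of (l, j) \<Rightarrow> if l < n0 then f l j else 0) = (\<Sum>l<n0. \<Sum>j\<in>UNIV. f l j)"
proof -
  have "(\<Sum>i\<in>{..<n} \<times> UNIV. case i of (l, j) \<Rightarrow> if l < n0 then f l j else 0)
      = (\<Sum>l<n. \<Sum>j\<in>UNIV. if l < n0 then f l j else 0)"
    by (simp add: sum.cartesian_product)
  also have "\<dots> = (\<Sum>l<n0. \<Sum>j\<in>UNIV. f l j)"
    using assms by (intro sum.mono_neutral_cong_right) auto
  finally show ?thesis .
qed

lemma sum_split_block:
  fixes g :: "nat \<times> 'm::finite \<Rightarrow> real"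
  assumes "n0 \<le> n"
  shows "(\<Sum>i\<in>{..<n} \<times> UNIV. g i) = (\<Sum>l<n0. \<Sum>j\<in>UNIV. g (l, j)) + (\<Sum>i\<in>{n0..<n} \<times> UNIV. g i)"
proof -
  have "{..<n} \<times> (UNIV :: 'm set) = ({..<n0} \<times> UNIV) \<union> ({n0..<n} \<times> UNIV)" using assms by auto
  moreover have "({..<n0} \<times> (UNIV :: 'm set)) \<inter> ({n0..<n} \<times> UNIV) = {}" by auto
  ultimately have "(\<Sum>i\<in>{..<n} \<times> UNIV. g i) = (\<Sum>i\<in>{..<n0} \<times> UNIV. g i) + (\<Sum>i\<in>{n0..<n} \<times> UNIV. g i)"
    by (simp add: sum.union_disjoint)
  then show ?thesis by (simp add: sum.cartesian_product)
qed

text \<open>The orthonormal system consists of the vectors of \<open>B\<close> spread over the first stage and of all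
  coordinates of the second stage; it carries the mean, and the residuals are what it misses.\<close>

lemma (in prob_space) rss_mean_joint:
  fixes \<eta> :: "nat \<times> 'm::finite \<Rightarrow> 'a \<Rightarrow> real" and B :: "(real^'m) set" and a :: "real^'m"
  assumes iid: "iid_std_normal \<eta> ({..<n} \<times> UNIV)"
    and B: "finite B" "pairwise orthogonal B" "\<And>v. v \<in> B \<Longrightarrow> norm v = 1"
    and a: "a \<in> span B" "a \<noteq> 0" and n0: "0 < n0" "n0 \<le> n" and card: "card B < n0 * CARD('m)"
  shows "distr M (borel \<Otimes>\<^sub>M borel)
      (\<lambda>\<omega>. (rss_stat n0 B (\<lambda>l. \<chi> j. \<eta> (l, j) \<omega>), mean_stat a n (\<lambda>l. \<chi> j. \<eta> (l, j) \<omega>)))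
    = chisq_distribution (real (n0 * CARD('m) - card B)) \<Otimes>\<^sub>M std_normal_distribution"
proof -
  define I where "I = {..<n} \<times> (UNIV :: 'm set)"
  define T where "T = {n0..<n} \<times> (UNIV :: 'm set)"
  define K where "K = B <+> T"
  define q where "q = a \<bullet> a"
  define e :: "(real^'m) + (nat \<times> 'm) \<Rightarrow> nat \<times> 'm \<Rightarrow> real" where
    "e k = (case k of Inl v \<Rightarrow> (\<lambda>(l, j). if l < n0 then v $ j / sqrt n0 else 0)
                    | Inr z \<Rightarrow> (\<lambda>i. if i = z then 1 else 0))" for k
  define c :: "(real^'m) + (nat \<times> 'm) \<Rightarrow> real" where
    "c k = (case k of Inl v \<Rightarrow> (a \<bullet> v) * sqrt n0 / sqrt (n * q) | Inr z \<Rightarrow> a $ snd z / sqrt (n * q))" for k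
  have q: "q > 0" using a by (simp add: q_def)
  have n: "n > 0" using n0 by simp
  have fI: "finite I" and fT: "finite T" and TI: "T \<subseteq> I" by (auto simp: I_def T_def)
  have fK: "finite K" using B fT by (simp add: K_def)
  have e1: "e (Inl v) i = (case i of (l, j) \<Rightarrow> if l < n0 then v $ j / sqrt n0 else 0)" for v i
    by (simp add: e_def)
  have e2: "e (Inr z) i = (if i = z then 1 else 0)" for z i by (simp add: e_def)
  have YInl: "(\<Sum>i\<in>I. e (Inl v) i * g i) = (\<Sum>l<n0. \<Sum>j\<in>UNIV. v $ j * g (l, j)) / sqrt n0" for v and g :: "_ \<Rightarrow> real"
  proof -
    have "(\<Sum>i\<in>I. e (Inl v) i * g i)
        = (\<Sum>i\<in>I. case i of (l, j) \<Rightarrow> if l < n0 then v $ j * g (l, j) / sqrt n0 else 0)"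
      by (intro sum.cong) (auto simp: e1)
    then show ?thesis
      unfolding I_def sum_head_block[OF n0(2)] by (simp add: sum_divide_distrib)
  qed
  have YInr: "(\<Sum>i\<in>I. e (Inr z) i * g i) = g z" if "z \<in> T" for z and g :: "_ \<Rightarrow> real"
  proof -
    have "(\<Sum>i\<in>I. e (Inr z) i * g i) = (\<Sum>i\<in>I. if i = z then g i else 0)"
      by (intro sum.cong) (auto simp: e2)
    then show ?thesis using that TI fI by auto
  qed
  have orth: "orthonormal_on I K e"
    unfolding orthonormal_on_def
  proof (intro ballI)
    fix k k' assume k: "k \<in> K" and k': "k' \<in> K"
    have vT: "e (Inl v) z = 0" if "z \<in> T" for v z using that by (auto simp: e1 T_def)
    consider (ll) v w where "k = Inl v" "k' = Inl w" "v \<in> B" "w \<in> B"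
      | (lr) v z where "k = Inl v" "k' = Inr z" "z \<in> T"
      | (r) z where "k = Inr z" "z \<in> T"
      using k k' unfolding K_def by blast
    then show "(\<Sum>i\<in>I. e k i * e k' i) = (if k = k' then 1 else 0)"
    proof cases
      case ll
      have "(\<Sum>i\<in>I. e k i * e k' i) = (\<Sum>l<n0. \<Sum>j\<in>UNIV. v $ j * (w $ j / sqrt n0)) / sqrt n0"
        unfolding ll YInl by (simp add: e1)
      also have "\<dots> = v \<bullet> w"
        using n0 by (simp add: inner_vec_def sum_divide_distrib[symmetric] real_div_sqrt mult.commute)
      also have "\<dots> = (if v = w then 1 else 0)"
        using B(2,3) ll(3,4) by (auto simp: pairwise_def orthogonal_def norm_eq_1)
      finally show ?thesis using ll by simp
    next
      case lr
      have "(\<Sum>i\<in>I. e k i * e k' i) = (\<Sum>i\<in>I. e k' i * e k i)" by (simp add: mult.commute)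
      then show ?thesis using lr YInr[of z "e k"] vT by simp
    next
      case r
      then show ?thesis
      proof (cases k')
        case (Inl w) then show ?thesis using r YInr[of z "e k'"] vT by simp
      next
        case (Inr z') then show ?thesis using r YInr[of z "e k'"] by (simp add: e2)
      qed
    qed
  qed
  have ex: "(\<Sum>v\<in>B. (a \<bullet> v) *\<^sub>R v) = a" by (rule orthonormal_basis_expand[OF B(2,3) a(1) B(1)])
  have exi: "(\<Sum>v\<in>B. (a \<bullet> v) * (v \<bullet> y)) = a \<bullet> y" for y
  proof -
    have "a \<bullet> y = (\<Sum>v\<in>B. (a \<bullet> v) *\<^sub>R v) \<bullet> y" by (simp only: ex)
    then show ?thesis by (simp add: inner_sum_left)
  qed
  have sumT: "(\<Sum>z\<in>T. f (fst z) (snd z)) = (\<Sum>l=n0..<n. \<Sum>j\<in>UNIV. f l j)" for f :: "nat \<Rightarrow> 'm \<Rightarrow> real"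
    unfolding T_def by (simp add: sum.cartesian_product case_prod_beta')
  have c1: "(\<Sum>k\<in>K. (c k)\<^sup>2) = 1"
  proof -
    have "(\<Sum>v\<in>B. (c (Inl v))\<^sup>2) = real n0 / (n * q) * (\<Sum>v\<in>B. (a \<bullet> v) * (v \<bullet> a))"
      using q by (simp add: c_def power_divide power_mult_distrib sum_distrib_left power2_eq_square[of "_ \<bullet> _"] inner_commute mult_ac)
    also have "\<dots> = real n0 / n" using q unfolding exi by (simp add: q_def)
    finally have 1: "(\<Sum>v\<in>B. (c (Inl v))\<^sup>2) = real n0 / n" .
    have "(\<Sum>z\<in>T. (c (Inr z))\<^sup>2) = (\<Sum>z\<in>T. (a $ snd z * a $ snd z) / (n * q))"
      using q by (simp add: c_def power_divide power2_eq_square[of "a $ _"])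
    also have "\<dots> = (\<Sum>l=n0..<n. \<Sum>j\<in>UNIV. (a $ j * a $ j) / (n * q))"
      by (rule sumT[of "\<lambda>_ j. (a $ j * a $ j) / (n * q)"])
    also have "\<dots> = real (n - n0) / n"
      using q n by (simp add: sum_divide_distrib[symmetric] q_def inner_vec_def)
    finally have 2: "(\<Sum>z\<in>T. (c (Inr z))\<^sup>2) = real (n - n0) / n" .
    show ?thesis using 1 2 n n0 B(1) fT
      by (simp add: K_def sum.Plus add_divide_distrib[symmetric] of_nat_diff)
  qed
  have cI: "card I = n * CARD('m)" by (simp add: I_def card_cartesian_product)
  have cK: "card K = card B + (n - n0) * CARD('m)"
    using B fT by (simp add: K_def card_Plus T_def card_cartesian_product)
  have nn: "n * CARD('m) = n0 * CARD('m) + (n - n0) * CARD('m)"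
    using n0 by (simp add: add_mult_distrib[symmetric])
  have cKI: "card K < card I" and cd: "card I - card K = n0 * CARD('m) - card B"
    unfolding cI cK using nn card by linarith+
  have iid': "iid_std_normal \<eta> I" using iid by (simp add: I_def)
  define Y where "Y k \<omega> = (\<Sum>i\<in>I. e k i * \<eta> i \<omega>)" for k \<omega>
  let ?v = "\<lambda>\<omega> l. \<chi> j. \<eta> (l, j) \<omega>"
  have Y1: "Y (Inl v) \<omega> = (v \<bullet> (\<Sum>l<n0. ?v \<omega> l)) / sqrt n0" for v \<omega>
    unfolding Y_def YInl inner_sum_right by (simp add: inner_vec_def)
  have Y2: "Y (Inr z) \<omega> = \<eta> z \<omega>" if "z \<in> T" for z \<omega>
    unfolding Y_def using YInr[OF that] .
  have C: "(\<Sum>i\<in>I. (\<eta> i \<omega>)\<^sup>2) - (\<Sum>k\<in>K. (Y k \<omega>)\<^sup>2) = rss_stat n0 B (?v \<omega>)" for \<omega>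
  proof -
    have "(\<Sum>k\<in>K. (Y k \<omega>)\<^sup>2) = (\<Sum>v\<in>B. (v \<bullet> (\<Sum>l<n0. ?v \<omega> l))\<^sup>2) / n0 + (\<Sum>z\<in>T. (\<eta> z \<omega>)\<^sup>2)"
      using B(1) fT Y2 by (simp add: K_def sum.Plus Y1 power_divide sum_divide_distrib)
    moreover have "(\<Sum>i\<in>I. (\<eta> i \<omega>)\<^sup>2) = (\<Sum>l<n0. \<Sum>j\<in>UNIV. (\<eta> (l, j) \<omega>)\<^sup>2) + (\<Sum>z\<in>T. (\<eta> z \<omega>)\<^sup>2)"
      unfolding I_def T_def by (rule sum_split_block[OF n0(2)])
    ultimately show ?thesis by (simp add: rss_stat_def inner_vec_def power2_eq_square)
  qed
  have U: "(\<Sum>k\<in>K. c k * Y k \<omega>) = mean_stat a n (?v \<omega>)" for \<omega>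
  proof -
    have "(\<Sum>v\<in>B. c (Inl v) * Y (Inl v) \<omega>) = (\<Sum>v\<in>B. (a \<bullet> v) * (v \<bullet> (\<Sum>l<n0. ?v \<omega> l))) / sqrt (n * q)"
      unfolding sum_divide_distrib using n0 by (intro sum.cong) (auto simp: c_def Y1)
    also have "\<dots> = (\<Sum>l<n0. a \<bullet> ?v \<omega> l) / sqrt (n * q)" unfolding exi by (simp add: inner_sum_right)
    finally have 1: "(\<Sum>v\<in>B. c (Inl v) * Y (Inl v) \<omega>) = (\<Sum>l<n0. a \<bullet> ?v \<omega> l) / sqrt (n * q)" .
    have "(\<Sum>z\<in>T. c (Inr z) * Y (Inr z) \<omega>) = (\<Sum>z\<in>T. (a $ snd z * \<eta> (fst z, snd z) \<omega>) / sqrt (n * q))"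
      by (intro sum.cong) (auto simp: c_def Y2)
    also have "\<dots> = (\<Sum>l=n0..<n. \<Sum>j\<in>UNIV. a $ j * \<eta> (l, j) \<omega> / sqrt (n * q))"
      by (rule sumT[of "\<lambda>l j. a $ j * \<eta> (l, j) \<omega> / sqrt (n * q)"])
    also have "\<dots> = (\<Sum>l=n0..<n. a \<bullet> ?v \<omega> l) / sqrt (n * q)"
      by (simp add: inner_vec_def sum_divide_distrib)
    finally have 2: "(\<Sum>z\<in>T. c (Inr z) * Y (Inr z) \<omega>) = (\<Sum>l=n0..<n. a \<bullet> ?v \<omega> l) / sqrt (n * q)" .
    have "(\<Sum>l<n. a \<bullet> ?v \<omega> l) = (\<Sum>l<n0. a \<bullet> ?v \<omega> l) + (\<Sum>l=n0..<n. a \<bullet> ?v \<omega> l)"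
      using n0 by (metis atLeast0LessThan le0 sum.atLeastLessThan_concat)
    then show ?thesis
      using 1 2 B(1) fT by (simp add: K_def sum.Plus mean_stat_def q_def add_divide_distrib)
  qed
  show ?thesis
    using iid_std_normal_residual_joint[OF iid' fI fK orth c1 cKI, folded Y_def]
    by (simp only: C U cd)
qed

definition stage_size :: "real \<Rightarrow> real \<Rightarrow> nat \<Rightarrow> real \<Rightarrow> real \<Rightarrow> real \<Rightarrow> nat" where
  "stage_size h \<delta> n0 \<nu> \<sigma> s = max (nat \<lceil>h\<^sup>2 * (\<sigma>\<^sup>2 * s / \<nu>) / \<delta>\<^sup>2\<rceil>) n0"

lemma measurable_stage_size[measurable]: "stage_size h \<delta> n0 \<nu> \<sigma> \<in> borel \<rightarrow>\<^sub>M count_space UNIV"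
  unfolding stage_size_def by measurable

lemma stage_size_ge: "n0 \<le> stage_size h \<delta> n0 \<nu> \<sigma> s"
  by (simp add: stage_size_def)

lemma stage_size_ge_real: "h\<^sup>2 * (\<sigma>\<^sup>2 * s / \<nu>) / \<delta>\<^sup>2 \<le> real (stage_size h \<delta> n0 \<nu> \<sigma> s)"
proof -
  have "h\<^sup>2 * (\<sigma>\<^sup>2 * s / \<nu>) / \<delta>\<^sup>2 \<le> real (nat \<lceil>h\<^sup>2 * (\<sigma>\<^sup>2 * s / \<nu>) / \<delta>\<^sup>2\<rceil>)" by (rule real_nat_ceiling_ge)
  also have "\<dots> \<le> real (stage_size h \<delta> n0 \<nu> \<sigma> s)" by (simp add: stage_size_def)
  finally show ?thesis .
qed

definition orthonormal_basis_of :: "('v::euclidean_space) set \<Rightarrow> 'v set \<Rightarrow> bool" where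
  "orthonormal_basis_of S B \<longleftrightarrow>
     finite B \<and> B \<subseteq> S \<and> pairwise orthogonal B \<and> (\<forall>v\<in>B. norm v = 1) \<and> card B = dim S \<and> span B = S"

lemma orthonormal_basis_of_exists:
  assumes "subspace S"
  obtains B where "orthonormal_basis_of S B"
proof -
  obtain B where "B \<subseteq> S" "pairwise orthogonal B" "\<And>x. x \<in> B \<Longrightarrow> norm x = 1" "independent B"
    "card B = dim S" "span B = S"
    using orthonormal_basis_subspace[OF assms] by metis
  then show ?thesis using that[of B] by (auto simp: orthonormal_basis_of_def independent_imp_finite)
qed

context full_rank_design
begin

lemma dof_eq:
  assumes "0 < n0"
  shows "dof n0 X = real (n0 * CARD('m) - CARD('p))"
proof -
  have "CARD('p) \<le> n0 * CARD('m)" using card_le assms by (metis One_nat_def Suc_leI le_trans mult_le_mono1 nat_mult_1)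
  then show ?thesis by (simp add: dof_def of_nat_diff)
qed

lemma dof_gt_0:
  assumes "2 \<le> n0"
  shows "CARD('p) < n0 * CARD('m)"
proof -
  have "CARD('p) < 2 * CARD('m)" using card_le zero_less_card_finite[where 'a='m] by linarith
  also have "\<dots> \<le> n0 * CARD('m)" using assms by simp
  finally show ?thesis .
qed

lemma first_stage_var_eq:
  assumes n0: "0 < n0" and B: "orthonormal_basis_of (range ((*v) X)) B" and \<sigma>: "0 < \<sigma>"
  shows "first_stage_var X n0 (\<lambda>l. X *v b + \<epsilon> l)
    = \<sigma>\<^sup>2 * rss_stat n0 B (\<lambda>l. (1 / \<sigma>) *\<^sub>R \<epsilon> l) / dof n0 X"
proof -
  have "\<sigma>\<^sup>2 * rss_stat n0 B (\<lambda>l. (1 / \<sigma>) *\<^sub>R \<epsilon> l) = rss_stat n0 B \<epsilon>"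
  proof -
    have 1: "(\<Sum>l<n0. ((1 / \<sigma>) *\<^sub>R \<epsilon> l) \<bullet> ((1 / \<sigma>) *\<^sub>R \<epsilon> l)) = (\<Sum>l<n0. \<epsilon> l \<bullet> \<epsilon> l) / \<sigma>\<^sup>2"
      by (simp add: sum_divide_distrib power2_eq_square)
    have "(v \<bullet> (\<Sum>l<n0. (1 / \<sigma>) *\<^sub>R \<epsilon> l))\<^sup>2 = (v \<bullet> (\<Sum>l<n0. \<epsilon> l))\<^sup>2 / \<sigma>\<^sup>2" for v
      by (simp add: scaleR_right.sum[symmetric] power_divide)
    then have 2: "(\<Sum>v\<in>B. (v \<bullet> (\<Sum>l<n0. (1 / \<sigma>) *\<^sub>R \<epsilon> l))\<^sup>2) = (\<Sum>v\<in>B. (v \<bullet> (\<Sum>l<n0. \<epsilon> l))\<^sup>2) / \<sigma>\<^sup>2"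
      by (simp add: sum_divide_distrib)
    show ?thesis unfolding rss_stat_def 1 2 using \<sigma> by (simp add: right_diff_distrib)
  qed
  then show ?thesis
    using B residual_sum_of_squares[OF n0, of B b \<epsilon>]
    by (simp add: first_stage_var_def rss_stat_def orthonormal_basis_of_def)
qed

lemma inner_ols_eq:
  assumes n: "0 < n" and \<sigma>: "0 < \<sigma>" and x: "x \<noteq> 0"
  shows "x \<bullet> ols X n (\<lambda>l. X *v b + \<epsilon> l)
    = x \<bullet> b + \<sigma> * sqrt (lever x \<bullet> lever x) / sqrt n * mean_stat (lever x) n (\<lambda>l. (1 / \<sigma>) *\<^sub>R \<epsilon> l)"
proof -
  have q: "lever x \<bullet> lever x > 0" using x by (simp add: lever_eq_0_iff)
  have "x \<bullet> ols X n (\<lambda>l. X *v b + \<epsilon> l) = x \<bullet> b + (lever x \<bullet> (\<Sum>l<n. \<epsilon> l)) / n"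
    by (simp add: ols_linear_model[OF n] inner_add_right inner_lever)
  also have "(lever x \<bullet> (\<Sum>l<n. \<epsilon> l)) / n
      = \<sigma> * sqrt (lever x \<bullet> lever x) / sqrt n * ((\<Sum>l<n. lever x \<bullet> \<epsilon> l) / \<sigma> / (sqrt n * sqrt (lever x \<bullet> lever x)))"
    using q \<sigma> n by (simp add: inner_sum_right field_simps)
  also have "(\<Sum>l<n. lever x \<bullet> \<epsilon> l) / \<sigma> / (sqrt n * sqrt (lever x \<bullet> lever x))
      = mean_stat (lever x) n (\<lambda>l. (1 / \<sigma>) *\<^sub>R \<epsilon> l)"
    by (simp add: mean_stat_def sum_divide_distrib real_sqrt_mult)
  finally show ?thesis .
qed

lemma inner_fdhom_beta_eq:
  fixes \<epsilon> :: "nat \<Rightarrow> real^'m" and h \<delta> :: real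
  assumes n0: "0 < n0" and B: "orthonormal_basis_of (range ((*v) X)) B" and \<sigma>: "0 < \<sigma>" and x: "x \<noteq> 0"
  defines "e \<equiv> \<lambda>l. (1 / \<sigma>) *\<^sub>R \<epsilon> l"
  defines "\<tau> \<equiv> stage_size h \<delta> n0 (dof n0 X) \<sigma> (rss_stat n0 B e)"
  shows "x \<bullet> fdhom_beta h \<delta> n0 X (\<lambda>l. X *v b + \<epsilon> l)
    = x \<bullet> b + \<sigma> * sqrt (lever x \<bullet> lever x) / sqrt \<tau> * mean_stat (lever x) \<tau> e"
proof -
  have "total_size h \<delta> n0 X (\<lambda>l. X *v b + \<epsilon> l) = \<tau>"
    unfolding total_size_def \<tau>_def stage_size_def e_def by (simp add: first_stage_var_eq[OF n0 B \<sigma>])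
  moreover have "0 < \<tau>" using n0 stage_size_ge unfolding \<tau>_def by (rule less_le_trans)
  ultimately show ?thesis
    unfolding fdhom_beta_def e_def using inner_ols_eq[OF _ \<sigma> x] by simp
qed

end

lemma measurable_stats:
  fixes f :: "nat \<Rightarrow> 'm::finite \<Rightarrow> 'b \<Rightarrow> real" and B :: "(real^'m) set"
  assumes [measurable]: "\<And>l j. f l j \<in> borel_measurable N"
  shows "(\<lambda>x. rss_stat n0 B (\<lambda>l. \<chi> j. f l j x)) \<in> borel_measurable N"
    and "(\<lambda>x. mean_stat a n (\<lambda>l. \<chi> j. f l j x)) \<in> borel_measurable N"
  unfolding rss_stat_def mean_stat_def inner_sum_right by (simp_all add: inner_vec_def)

lemma (in prob_space) two_stage_statistics_distr_PiM:
  fixes \<eta> :: "nat \<Rightarrow> nat \<Rightarrow> 'm::finite \<Rightarrow> 'a \<Rightarrow> real" and B :: "(real^'m) set"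
  assumes k: "0 < k"
    and ind: "indep_vars (\<lambda>_. borel) (\<lambda>(i, l, j). \<eta> i l j) ({..<k} \<times> UNIV \<times> UNIV)"
    and nrm: "\<And>i l j. i < k \<Longrightarrow> distr M borel (\<eta> i l j) = std_normal_distribution"
    and B: "finite B" "pairwise orthogonal B" "\<And>v. v \<in> B \<Longrightarrow> norm v = 1"
    and a: "a \<in> span B" "a \<noteq> 0" and n0: "0 < n0" and card: "card B < n0 * CARD('m)"
    and \<tau>: "\<And>i. \<tau> i \<in> borel \<rightarrow>\<^sub>M count_space UNIV" "\<And>i s. n0 \<le> \<tau> i s"
  defines "C \<equiv> \<lambda>i \<omega>. rss_stat n0 B (\<lambda>l. \<chi> j. \<eta> i l j \<omega>)"
  defines "W \<equiv> \<lambda>i \<omega>. mean_stat a (\<tau> i (C i \<omega>)) (\<lambda>l. \<chi> j. \<eta> i l j \<omega>)"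
  shows "distr M (PiM {..<k} (\<lambda>_. borel \<Otimes>\<^sub>M borel)) (\<lambda>\<omega>. \<lambda>i\<in>{..<k}. (C i \<omega>, W i \<omega>))
    = PiM {..<k} (\<lambda>_. chisq_distribution (real (n0 * CARD('m) - card B)) \<Otimes>\<^sub>M std_normal_distribution)"
    (is "_ = PiM _ (\<lambda>_. ?Q \<Otimes>\<^sub>M ?N)")
proof -
  note [measurable] = \<tau>(1)
  have etam: "\<eta> i l j \<in> borel_measurable M" if "i < k" for i l j
    using ind that unfolding indep_vars_def by auto
  have iid: "iid_std_normal (\<lambda>(l, j). \<eta> i l j) ({..<n} \<times> UNIV)" if i: "i < k" for i n
  proof -
    have "indep_vars (\<lambda>_. borel)
        (\<lambda>z \<omega>. (\<lambda>f. f (i, z)) (restrict (\<lambda>y. (case y of (i, l, j) \<Rightarrow> \<eta> i l j) \<omega>) {(i, z)})) ({..<n} \<times> UNIV)"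
      by (rule indep_vars_compose2[OF indep_vars_restrict[OF ind, where K="\<lambda>z. {(i, z)}"]])
        (use i in \<open>auto simp: disjoint_family_on_def\<close>)
    also have "(\<lambda>z \<omega>. (\<lambda>f. f (i, z)) (restrict (\<lambda>y. (case y of (i, l, j) \<Rightarrow> \<eta> i l j) \<omega>) {(i, z)}))
        = (\<lambda>(l, j). \<eta> i l j)" by (auto simp: fun_eq_iff)
    finally show ?thesis using nrm[OF i] by (auto simp: iid_std_normal_def)
  qed
  have Cm: "C i \<in> borel_measurable M" if "i < k" for i
    unfolding C_def using etam[OF that] by (intro measurable_stats) auto
  have law: "distr M (borel \<Otimes>\<^sub>M borel) (\<lambda>\<omega>. (C i \<omega>, W i \<omega>)) = ?Q \<Otimes>\<^sub>M ?N" if i: "i < k" for i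
    unfolding W_def
  proof (rule distr_pair_random_index[where \<tau>="\<tau> i" and U="\<lambda>n \<omega>. mean_stat a n (\<lambda>l. \<chi> j. \<eta> i l j \<omega>)"])
    fix n assume "n \<in> range (\<tau> i)"
    then have "n0 \<le> n" using \<tau>(2) by auto
    from rss_mean_joint[OF iid[OF i] B a n0 this card]
    show "distr M (borel \<Otimes>\<^sub>M borel) (\<lambda>\<omega>. (C i \<omega>, mean_stat a n (\<lambda>l. \<chi> j. \<eta> i l j \<omega>))) = ?Q \<Otimes>\<^sub>M ?N"
      by (simp add: C_def)
  next
    show "(\<lambda>\<omega>. mean_stat a n (\<lambda>l. \<chi> j. \<eta> i l j \<omega>)) \<in> borel_measurable M" for n
      using etam[OF i] by (intro measurable_stats) auto
  next
    show "prob_space ?Q" by (rule prob_space_chisq_distribution) (use card in simp)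
  qed (use Cm[OF i] in \<open>auto intro!: prob_space_std_normal\<close>)
  define g where "g i f = (let c = rss_stat n0 B (\<lambda>l. \<chi> j. f (i, l, j))
      in (c, mean_stat a (\<tau> i c) (\<lambda>l. \<chi> j. f (i, l, j))))" for i and f :: "nat \<times> nat \<times> 'm \<Rightarrow> real"
  have gm: "g i \<in> PiM ({i} \<times> UNIV \<times> UNIV) (\<lambda>_. borel) \<rightarrow>\<^sub>M borel \<Otimes>\<^sub>M borel" for i
  proof -
    let ?P = "PiM ({i} \<times> UNIV \<times> UNIV) (\<lambda>_. borel :: real measure) :: (nat \<times> nat \<times> 'm \<Rightarrow> real) measure"
    have [measurable]: "(\<lambda>f. rss_stat n0 B (\<lambda>l. \<chi> j. f (i, l, j))) \<in> borel_measurable ?P"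
      by (rule measurable_stats) (auto intro: measurable_component_singleton)
    have [measurable]: "(\<lambda>f. mean_stat a n (\<lambda>l. \<chi> j. f (i, l, j))) \<in> borel_measurable ?P" for n
      by (rule measurable_stats) (auto intro: measurable_component_singleton)
    have "(\<lambda>f. mean_stat a (\<tau> i (rss_stat n0 B (\<lambda>l. \<chi> j. f (i, l, j)))) (\<lambda>l. \<chi> j. f (i, l, j))) \<in> borel_measurable ?P"
      by (rule measurable_compose_countable[where g="\<lambda>f. \<tau> i (rss_stat n0 B (\<lambda>l. \<chi> j. f (i, l, j)))"
            and f="\<lambda>n f. mean_stat a n (\<lambda>l. \<chi> j. f (i, l, j))"]) measurable
    then show ?thesis unfolding g_def Let_def by measurable
  qed
  have "indep_vars (\<lambda>_. borel \<Otimes>\<^sub>M borel)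
      (\<lambda>i \<omega>. g i (restrict (\<lambda>y. (case y of (i, l, j) \<Rightarrow> \<eta> i l j) \<omega>) ({i} \<times> UNIV \<times> UNIV))) {..<k}"
    by (rule indep_vars_compose2[OF indep_vars_restrict[OF ind, where K="\<lambda>i. {i} \<times> UNIV \<times> UNIV"] gm])
      (auto simp: disjoint_family_on_def)
  then have iv: "indep_vars (\<lambda>_. borel \<Otimes>\<^sub>M borel) (\<lambda>i \<omega>. (C i \<omega>, W i \<omega>)) {..<k}"
    by (simp add: g_def C_def W_def Let_def)
  then have rv: "\<And>i. i < k \<Longrightarrow> (\<lambda>\<omega>. (C i \<omega>, W i \<omega>)) \<in> M \<rightarrow>\<^sub>M borel \<Otimes>\<^sub>M borel"
    unfolding indep_vars_def by auto
  have "distr M (PiM {..<k} (\<lambda>_. borel \<Otimes>\<^sub>M borel)) (\<lambda>\<omega>. \<lambda>i\<in>{..<k}. (C i \<omega>, W i \<omega>))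
      = PiM {..<k} (\<lambda>i. distr M (borel \<Otimes>\<^sub>M borel) (\<lambda>\<omega>. (C i \<omega>, W i \<omega>)))"
    using iv rv k by (subst indep_vars_iff_distr_eq_PiM'[symmetric]) auto
  also have "\<dots> = PiM {..<k} (\<lambda>_. ?Q \<Otimes>\<^sub>M ?N)" by (rule PiM_cong) (simp_all add: law)
  finally show ?thesis .
qed

section \<open>The equation defining the threshold\<close>

lemma borel_measurable_chisq_density[measurable]: "chisq_density \<nu> \<in> borel_measurable borel"
  unfolding chisq_density_def by measurable

lemma chisq_density_nonneg: "0 < \<nu> \<Longrightarrow> 0 \<le> chisq_density \<nu> s"
  by (simp add: chisq_density_def Gamma_real_pos less_imp_le)

lemma AE_chisq_distribution_pos: "AE s in chisq_distribution \<nu>. 0 < s"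
  unfolding chisq_distribution_def by (subst AE_density) (auto simp: chisq_density_def)

lemma set_integral_chisq:
  assumes "0 < \<nu>" and [measurable]: "f \<in> borel_measurable borel"
  shows "(LINT s:{0<..}|lborel. f s * chisq_density \<nu> s) = (\<integral>s. f s \<partial>chisq_distribution \<nu>)"
proof -
  have "(LINT s:{0<..}|lborel. f s * chisq_density \<nu> s) = (\<integral>s. chisq_density \<nu> s *\<^sub>R f s \<partial>lborel)"
    unfolding set_lebesgue_integral_def
    by (intro Bochner_Integration.integral_cong) (auto simp: chisq_density_def indicator_def)
  also have "\<dots> = (\<integral>s. f s \<partial>chisq_distribution \<nu>)"
    unfolding chisq_distribution_def using chisq_density_nonneg[OF assms(1)]
    by (subst integral_density) auto
  finally show ?thesis .
qed

definition pairwise_prob :: "real \<Rightarrow> real \<Rightarrow> real \<Rightarrow> real \<Rightarrow> real" where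
  "pairwise_prob \<nu> q h t = (\<integral>s. std_normal_cdf (h / sqrt (\<nu> * (1 / t + 1 / s) * q)) \<partial>chisq_distribution \<nu>)"

lemma borel_measurable_pairwise_prob:
  assumes "0 < n"
  shows "pairwise_prob (real n) q h \<in> borel_measurable borel"
proof -
  interpret Q: prob_space "chisq_distribution (real n)" by (rule prob_space_chisq_distribution[OF assms])
  show ?thesis unfolding pairwise_prob_def[abs_def]
    by (rule Q.borel_measurable_lebesgue_integral) measurable
qed

lemma pairwise_prob_bounds:
  assumes "0 < n"
  shows "0 \<le> pairwise_prob (real n) q h t" "pairwise_prob (real n) q h t \<le> 1"
proof -
  interpret Q: prob_space "chisq_distribution (real n)" by (rule prob_space_chisq_distribution[OF assms])
  show "0 \<le> pairwise_prob (real n) q h t"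
    by (simp add: pairwise_prob_def std_normal_cdf_nonneg)
  show "pairwise_prob (real n) q h t \<le> 1"
    unfolding pairwise_prob_def
    by (rule Q.integral_le_const) (auto intro!: Q.integrable_unit_interval simp: std_normal_cdf_nonneg std_normal_cdf_le_1)
qed

lemma hom_G_eq:
  fixes X :: "real^'p::finite^'m::finite"
  assumes \<nu>: "dof n0 X = real n" "0 < n"
  shows "hom_G k n0 X x h
    = (\<integral>t. pairwise_prob (real n) (x \<bullet> (matrix_inv (transpose X ** X) *v x)) h t ^ (k - 1) \<partial>chisq_distribution (real n))"
proof -
  note [measurable] = borel_measurable_pairwise_prob[OF \<nu>(2)]
  have n: "0 < real n" using \<nu> by simp
  let ?q = "x \<bullet> (matrix_inv (transpose X ** X) *v x)"
  have inner: "(LINT s:{0<..}|lborel. std_normal_cdf (h / sqrt (real n * (1 / t + 1 / s) * ?q)) * chisq_density (real n) s)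
      = pairwise_prob (real n) ?q h t" for t
    unfolding pairwise_prob_def by (rule set_integral_chisq[OF n]) measurable
  show ?thesis
    unfolding hom_G_def Let_def \<nu>(1) inner by (rule set_integral_chisq[OF n]) measurable
qed

lemma std_normal_cdf_nonpos:
  assumes "z \<le> 0"
  shows "std_normal_cdf z \<le> 1 / 2"
proof -
  interpret N: prob_space std_normal_distribution by (rule prob_space_std_normal)
  have "N.prob {0<..} = measure (distr std_normal_distribution borel uminus) {0<..}"
    by (simp add: distr_std_normal_uminus)
  also have "\<dots> = N.prob {..<0}"
    by (subst measure_distr) (auto intro!: arg_cong[where f=N.prob])
  also have "\<dots> = N.prob {..0}"
  proof -
    have "{..0} = {..<0::real} \<union> {0}" by auto
    moreover have "{0} \<in> null_sets std_normal_distribution" by (intro null_setsI std_normal_singleton_null) simp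
    ultimately have "emeasure std_normal_distribution {..0} = emeasure std_normal_distribution {..<0}"
      using emeasure_Un_null_set[of "{..<0::real}" std_normal_distribution "{0}"] by simp
    then show ?thesis by (simp add: measure_def)
  qed
  finally have "N.prob {0<..} = N.prob {..0}" .
  moreover have "N.prob {0<..} = 1 - N.prob {..0}"
  proof -
    have "{0<..} = space std_normal_distribution - {..0::real}" by auto
    then show ?thesis using N.prob_compl[of "{..0}"] by simp
  qed
  ultimately have "std_normal_cdf 0 = 1 / 2" by (simp add: std_normal_cdf_def)
  then show ?thesis using monoD[OF mono_std_normal_cdf assms] by simp
qed

lemma hom_G_le_of_nonpos:
  fixes X :: "real^'p::finite^'m::finite"
  assumes \<nu>: "dof n0 X = real n" "0 < n" and q: "0 \<le> x \<bullet> (matrix_inv (transpose X ** X) *v x)"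
    and h: "h \<le> 0" and k: "0 < k"
  shows "hom_G k n0 X x h \<le> 1 / real k"
proof -
  let ?Q = "chisq_distribution (real n)" and ?q = "x \<bullet> (matrix_inv (transpose X ** X) *v x)"
  interpret Q: prob_space ?Q by (rule prob_space_chisq_distribution[OF \<nu>(2)])
  note [measurable] = borel_measurable_pairwise_prob[OF \<nu>(2)]
  note b = pairwise_prob_bounds[OF \<nu>(2)]
  have half: "pairwise_prob (real n) ?q h t \<le> 1 / 2" if t: "0 < t" for t
    unfolding pairwise_prob_def
  proof (rule Q.integral_le_const)
    show "integrable ?Q (\<lambda>s. std_normal_cdf (h / sqrt (real n * (1 / t + 1 / s) * ?q)))"
      by (auto intro!: Q.integrable_unit_interval simp: std_normal_cdf_nonneg std_normal_cdf_le_1)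
    show "AE s in ?Q. std_normal_cdf (h / sqrt (real n * (1 / t + 1 / s) * ?q)) \<le> 1 / 2"
      using AE_chisq_distribution_pos
    proof eventually_elim
      case (elim s)
      then have "0 \<le> sqrt (real n * (1 / t + 1 / s) * ?q)" using t q by simp
      then show ?case by (intro std_normal_cdf_nonpos divide_nonpos_nonneg h)
    qed
  qed
  have "hom_G k n0 X x h \<le> (1 / 2) ^ (k - 1)"
    unfolding hom_G_eq[OF \<nu>]
  proof (rule Q.integral_le_const)
    show "integrable ?Q (\<lambda>t. pairwise_prob (real n) ?q h t ^ (k - 1))"
      using b by (intro Q.integrable_unit_interval) (auto intro: power_le_one)
    show "AE t in ?Q. pairwise_prob (real n) ?q h t ^ (k - 1) \<le> (1 / 2) ^ (k - 1)"
      using AE_chisq_distribution_pos by eventually_elim (intro power_mono half b)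
  qed
  also have "\<dots> \<le> 1 / real k"
  proof -
    have "k \<le> 2 ^ (k - 1)" using k less_exp[of "k - 1"] by linarith
    then have "real k \<le> 2 ^ (k - 1)" by (metis of_nat_le_iff of_nat_numeral of_nat_power)
    then show ?thesis using k by (simp add: power_one_over field_simps)
  qed
  finally show ?thesis .
qed

lemma hom_G_nonneg:
  fixes X :: "real^'p::finite^'m::finite"
  assumes \<nu>: "dof n0 X = real n" "0 < n"
  shows "0 \<le> hom_G k n0 X x h"
  unfolding hom_G_eq[OF \<nu>] using pairwise_prob_bounds[OF \<nu>(2)] by (intro integral_nonneg_AE AE_I2) simp

lemma stage_size_margin:
  fixes h \<delta> \<nu> q s t N N' \<sigma> \<sigma>' :: real
  assumes pos: "0 < h" "0 < \<delta>" "0 < \<nu>" "0 < q" "0 < s" "0 < t" "0 < \<sigma>" "0 < \<sigma>'"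
    and N: "h\<^sup>2 * (\<sigma>\<^sup>2 * s / \<nu>) / \<delta>\<^sup>2 \<le> N" and N': "h\<^sup>2 * (\<sigma>'\<^sup>2 * t / \<nu>) / \<delta>\<^sup>2 \<le> N'"
  shows "h / sqrt (\<nu> * (1 / t + 1 / s) * q)
    \<le> \<delta> / sqrt ((\<sigma> * sqrt q / sqrt N)\<^sup>2 + (\<sigma>' * sqrt q / sqrt N')\<^sup>2)"
proof -
  have bound: "(\<sigma> * sqrt q / sqrt N)\<^sup>2 \<le> (\<delta> / h)\<^sup>2 * (\<nu> * (1 / s) * q)" and "0 < N"
    if s: "0 < s" and \<sigma>: "0 < \<sigma>" and N: "h\<^sup>2 * (\<sigma>\<^sup>2 * s / \<nu>) / \<delta>\<^sup>2 \<le> N" for s \<sigma> N :: real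
  proof -
    have p: "0 < h\<^sup>2 * (\<sigma>\<^sup>2 * s / \<nu>) / \<delta>\<^sup>2" using pos s \<sigma> by simp
    then show N0: "0 < N" using N by linarith
    have "(\<sigma> * sqrt q / sqrt N)\<^sup>2 = \<sigma>\<^sup>2 * q / N"
      using pos N0 by (simp add: power_divide power_mult_distrib)
    also have "\<dots> \<le> \<sigma>\<^sup>2 * q / (h\<^sup>2 * (\<sigma>\<^sup>2 * s / \<nu>) / \<delta>\<^sup>2)"
      using pos by (intro divide_left_mono N mult_pos_pos N0 p) auto
    also have "\<dots> = (\<delta> / h)\<^sup>2 * (\<nu> * (1 / s) * q)"
      using pos s \<sigma> by (simp add: field_simps)
    finally show "(\<sigma> * sqrt q / sqrt N)\<^sup>2 \<le> (\<delta> / h)\<^sup>2 * (\<nu> * (1 / s) * q)" .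
  qed
  let ?S = "(\<sigma> * sqrt q / sqrt N)\<^sup>2 + (\<sigma>' * sqrt q / sqrt N')\<^sup>2"
  have N0: "0 < N" by (rule \<open>\<And>s \<sigma> N. 0 < s \<Longrightarrow> 0 < \<sigma> \<Longrightarrow> _ \<Longrightarrow> 0 < N\<close>[OF pos(5,7) N])
  have "?S \<le> (\<delta> / h)\<^sup>2 * (\<nu> * (1 / s) * q) + (\<delta> / h)\<^sup>2 * (\<nu> * (1 / t) * q)"
    by (intro add_mono bound pos N N')
  also have "\<dots> = (\<delta> / h)\<^sup>2 * (\<nu> * (1 / t + 1 / s) * q)" by (simp add: algebra_simps)
  finally have "sqrt ?S \<le> sqrt ((\<delta> / h)\<^sup>2 * (\<nu> * (1 / t + 1 / s) * q))" by (rule real_sqrt_le_mono)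
  also have "\<dots> = \<delta> / h * sqrt (\<nu> * (1 / t + 1 / s) * q)"
    using pos by (simp add: real_sqrt_mult)
  finally have le: "sqrt ?S \<le> \<delta> / h * sqrt (\<nu> * (1 / t + 1 / s) * q)" .
  have "0 < (\<sigma> * sqrt q / sqrt N)\<^sup>2" using pos N0 by simp
  then have S0: "0 < sqrt ?S" by (simp add: add_pos_nonneg)
  have D0: "0 < \<nu> * (1 / t + 1 / s) * q" using pos by (intro mult_pos_pos add_pos_pos) auto
  have "h / sqrt (\<nu> * (1 / t + 1 / s) * q) = \<delta> / (\<delta> / h * sqrt (\<nu> * (1 / t + 1 / s) * q))"
    using pos by simp
  also have "\<dots> \<le> \<delta> / sqrt ?S"
    using pos le S0 D0 by (intro divide_left_mono mult_pos_pos) auto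
  finally show ?thesis .
qed

lemma selection_correct:
  fixes b bh :: "nat \<Rightarrow> real"
  assumes k: "0 < k" and i0: "i0 < k" and Max: "(MAX i\<in>{..<k}. b i) = b i0"
    and ev: "\<And>j. j < k \<Longrightarrow> j \<noteq> i0 \<Longrightarrow> bh j - b j < bh i0 - b i0 + \<delta>" and \<delta>: "0 < \<delta>"
  shows "(MAX i\<in>{..<k}. b i) - b (LEAST i. i < k \<and> (\<forall>j<k. bh j \<le> bh i)) < \<delta>"
proof -
  define s where "s = (LEAST i. i < k \<and> (\<forall>j<k. bh j \<le> bh i))"
  have "Max (bh ` {..<k}) \<in> bh ` {..<k}" using k by (intro Max_in) auto
  then obtain m where m: "m < k" "bh m = Max (bh ` {..<k})" by auto
  then have "m < k \<and> (\<forall>j<k. bh j \<le> bh m)" by auto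
  then have s: "s < k" "\<forall>j<k. bh j \<le> bh s"
    using LeastI[of "\<lambda>i. i < k \<and> (\<forall>j<k. bh j \<le> bh i)" m] unfolding s_def by blast+
  show ?thesis unfolding Max s_def[symmetric]
  proof (cases "s = i0")
    case False
    then show "b i0 - b s < \<delta>" using ev[OF s(1)] s(2) i0 by fastforce
  qed (use \<delta> in simp)
qed

section \<open>Validity of the procedure\<close>

lemma borel_measurable_matrix_vector_mult:
  fixes A :: "real^'b::finite^'c::finite"
  assumes "f \<in> borel_measurable N"
  shows "(\<lambda>x. A *v f x) \<in> borel_measurable N"
  by (rule measurable_compose[OF assms borel_measurable_continuous_onI])
    (rule linear_continuous_on[OF matrix_vector_mul_bounded_linear])

lemma borel_measurable_vec_lambda:
  fixes f :: "'m::finite \<Rightarrow> 'b \<Rightarrow> real"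
  assumes "\<And>j. f j \<in> borel_measurable N"
  shows "(\<lambda>x. \<chi> j. f j x) \<in> borel_measurable N"
  using assms by (subst borel_measurable_euclidean_space) (auto simp: Basis_vec_def inner_axis)

lemma borel_measurable_ols:
  fixes X :: "real^'p::finite^'m::finite"
  assumes "\<And>l. Y l \<in> borel_measurable N"
  shows "(\<lambda>x. ols X n (\<lambda>l. Y l x)) \<in> borel_measurable N"
  unfolding ols_def using assms
  by (intro borel_measurable_scaleR borel_measurable_matrix_vector_mult borel_measurable_sum) auto

lemma borel_measurable_fdhom_beta:
  fixes X :: "real^'p::finite^'m::finite"
  assumes Y: "\<And>l. Y l \<in> borel_measurable N"
  shows "(\<lambda>x. fdhom_beta h \<delta> n0 X (\<lambda>l. Y l x)) \<in> borel_measurable N"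
proof -
  note [measurable] = Y borel_measurable_ols[OF Y]
  have [measurable]: "(\<lambda>x. X *v ols X n0 (\<lambda>l. Y l x)) \<in> borel_measurable N"
    by (intro borel_measurable_matrix_vector_mult) measurable
  have "(\<lambda>x. first_stage_var X n0 (\<lambda>l. Y l x)) \<in> borel_measurable N"
    unfolding first_stage_var_def by measurable
  then have [measurable]: "(\<lambda>x. total_size h \<delta> n0 X (\<lambda>l. Y l x)) \<in> N \<rightarrow>\<^sub>M count_space UNIV"
    unfolding total_size_def by measurable
  show ?thesis unfolding fdhom_beta_def
    by (rule measurable_compose_countable[where g="\<lambda>x. total_size h \<delta> n0 X (\<lambda>l. Y l x)"
          and f="\<lambda>n x. ols X n (\<lambda>l. Y l x)"]) measurable
qed

lemma sets_correct_selection: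
  fixes bh :: "nat \<Rightarrow> 'a \<Rightarrow> real^'p::finite"
  assumes bh: "\<And>j. j < k \<Longrightarrow> bh j \<in> borel_measurable M"
  shows "{z \<in> space (borel \<Otimes>\<^sub>M M). (MAX i\<in>{..<k}. fst z \<bullet> \<beta> i)
      - fst z \<bullet> \<beta> (LEAST i. i < k \<and> (\<forall>j<k. fst z \<bullet> bh j (snd z) \<le> fst z \<bullet> bh i (snd z))) < \<delta>}
    \<in> sets (borel \<Otimes>\<^sub>M M)"
proof -
  let ?P = "borel \<Otimes>\<^sub>M M :: ((real^'p) \<times> 'a) measure"
  have im: "(\<lambda>z. fst z \<bullet> bh j (snd z)) \<in> borel_measurable ?P" if "j < k" for j
    using measurable_compose[OF measurable_snd bh[OF that], of borel] by measurable
  have pm: "Measurable.pred ?P (\<lambda>z. i < k \<and> (\<forall>j<k. fst z \<bullet> bh j (snd z) \<le> fst z \<bullet> bh i (snd z)))" for i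
  proof (cases "i < k")
    case True
    have "Measurable.pred ?P (\<lambda>z. \<forall>j\<in>{..<k}. fst z \<bullet> bh j (snd z) \<le> fst z \<bullet> bh i (snd z))"
    proof (intro pred_intros_finite finite_lessThan)
      fix j assume "j \<in> {..<k}"
      then have [measurable]: "(\<lambda>z. fst z \<bullet> bh j (snd z)) \<in> borel_measurable ?P"
        "(\<lambda>z. fst z \<bullet> bh i (snd z)) \<in> borel_measurable ?P" using im True by auto
      show "Measurable.pred ?P (\<lambda>z. fst z \<bullet> bh j (snd z) \<le> fst z \<bullet> bh i (snd z))" by measurable
    qed
    then show ?thesis by (simp only: True Ball_def lessThan_iff simp_thms)
  next
    case False
    then show ?thesis by (simp only: simp_thms measurable_const space_count_space UNIV_I)
  qed
  define s where "s z = (LEAST i. i < k \<and> (\<forall>j<k. fst z \<bullet> bh j (snd z) \<le> fst z \<bullet> bh i (snd z)))" for z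
  have sm[measurable]: "s \<in> ?P \<rightarrow>\<^sub>M count_space UNIV"
    unfolding s_def by (rule measurable_Least) (rule pm)
  have [measurable]: "(\<lambda>z. fst z \<bullet> \<beta> (s z)) \<in> borel_measurable ?P"
    by (rule measurable_compose_countable[where g=s and f="\<lambda>i z. fst z \<bullet> \<beta> i"]) measurable
  have [measurable]: "(\<lambda>z. MAX i\<in>{..<k}. fst z \<bullet> \<beta> i) \<in> borel_measurable ?P"
    by (rule borel_measurable_Max) measurable
  have "{z \<in> space ?P. (MAX i\<in>{..<k}. fst z \<bullet> \<beta> i) - fst z \<bullet> \<beta> (s z) < \<delta>} \<in> sets ?P"
    by measurable
  then show ?thesis by (simp only: s_def)
qed

locale fdhom_model = prob_space M + full_rank_design "design_matrix xs"
  for M :: "'a measure" and xs :: "'m::finite \<Rightarrow> real^'p::finite" +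
  fixes k n0 :: nat and \<delta> :: real and \<beta> :: "nat \<Rightarrow> real^'p" and \<sigma> :: "nat \<Rightarrow> real"
    and \<epsilon> :: "nat \<Rightarrow> nat \<Rightarrow> 'm \<Rightarrow> 'a \<Rightarrow> real"
  assumes k: "0 < k" and \<delta>: "0 < \<delta>" and n0: "2 \<le> n0"
    and \<sigma>: "\<And>i. i < k \<Longrightarrow> 0 < \<sigma> i"
    and normal: "\<And>i l j. i < k \<Longrightarrow> distributed M lborel (\<epsilon> i l j) (normal_density 0 (\<sigma> i))"
    and indep: "indep_vars (\<lambda>_. borel) (\<lambda>(i, l, j). \<epsilon> i l j) ({..<k} \<times> UNIV \<times> UNIV)"
begin

abbreviation "X \<equiv> design_matrix xs"

definition "Y i l \<omega> = (\<chi> j. xs j \<bullet> \<beta> i + \<epsilon> i l j \<omega>)"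

definition "df = n0 * CARD('m) - CARD('p)"

lemma df_pos: "0 < df" using dof_gt_0[OF n0] by (simp add: df_def)

lemma dof_df: "dof n0 X = real df"
  using dof_eq[of n0] n0 by (simp add: df_def)

lemma Y_eq: "Y i l \<omega> = X *v \<beta> i + (\<chi> j. \<epsilon> i l j \<omega>)"
  by (simp add: Y_def vec_eq_iff matrix_vector_mult_def design_matrix_def inner_vec_def)

lemma \<epsilon>_measurable: "i < k \<Longrightarrow> \<epsilon> i l j \<in> borel_measurable M"
  using normal[of i l j] by (auto simp: distributed_def)

lemma beta_measurable:
  assumes "i < k"
  shows "(\<lambda>\<omega>. fdhom_beta h \<delta> n0 X (\<lambda>l. Y i l \<omega>)) \<in> borel_measurable M"
  using \<epsilon>_measurable[OF assms] unfolding Y_def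
  by (intro borel_measurable_fdhom_beta borel_measurable_vec_lambda) auto

lemma PCS_set_measurable:
  "{z \<in> space (borel \<Otimes>\<^sub>M M). (MAX i\<in>{..<k}. fst z \<bullet> \<beta> i)
      - fst z \<bullet> \<beta> (fdhom_select k h \<delta> n0 X (\<lambda>i l. Y i l (snd z)) (fst z)) < \<delta>} \<in> sets (borel \<Otimes>\<^sub>M M)"
  unfolding fdhom_select_def
  by (rule sets_correct_selection[where bh="\<lambda>i \<omega>. fdhom_beta h \<delta> n0 X (\<lambda>l. Y i l \<omega>)"]) (rule beta_measurable)

lemma PCS_measurable: "(\<lambda>x. fdhom_PCS M k h \<delta> n0 X \<beta> Y x) \<in> borel_measurable borel"
proof -
  let ?S = "{z \<in> space (borel \<Otimes>\<^sub>M M). (MAX i\<in>{..<k}. fst z \<bullet> \<beta> i)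
      - fst z \<bullet> \<beta> (fdhom_select k h \<delta> n0 X (\<lambda>i l. Y i l (snd z)) (fst z)) < \<delta>}"
  have "(\<lambda>x. emeasure M (Pair x -` ?S)) \<in> borel_measurable borel"
    by (rule measurable_emeasure_Pair[OF PCS_set_measurable])
  then have "(\<lambda>x. measure M (Pair x -` ?S)) \<in> borel_measurable borel"
    unfolding measure_def by measurable
  also have "(\<lambda>x. measure M (Pair x -` ?S)) = (\<lambda>x. fdhom_PCS M k h \<delta> n0 X \<beta> Y x)"
    unfolding fdhom_PCS_def
    by (intro ext arg_cong[where f="measure M"]) (auto simp: space_pair_measure)
  finally show ?thesis .
qed

lemma standardized_errors:
  defines "\<eta> \<equiv> \<lambda>i l j \<omega>. \<epsilon> i l j \<omega> / \<sigma> i"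
  shows "indep_vars (\<lambda>_. borel) (\<lambda>(i, l, j). \<eta> i l j) ({..<k} \<times> UNIV \<times> UNIV)"
    and "i < k \<Longrightarrow> distr M borel (\<eta> i l j) = std_normal_distribution"
proof -
  have "indep_vars (\<lambda>_. borel) (\<lambda>z \<omega>. (\<lambda>y. y / \<sigma> (fst z)) ((case z of (i, l, j) \<Rightarrow> \<epsilon> i l j) \<omega>)) ({..<k} \<times> UNIV \<times> UNIV)"
    by (rule indep_vars_compose2[OF indep]) simp
  also have "(\<lambda>z \<omega>. (\<lambda>y. y / \<sigma> (fst z)) ((case z of (i, l, j) \<Rightarrow> \<epsilon> i l j) \<omega>)) = (\<lambda>(i, l, j). \<eta> i l j)"
    by (auto simp: fun_eq_iff \<eta>_def)
  finally show "indep_vars (\<lambda>_. borel) (\<lambda>(i, l, j). \<eta> i l j) ({..<k} \<times> UNIV \<times> UNIV)" .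
  assume i: "i < k"
  have "distributed M lborel (\<lambda>\<omega>. (\<epsilon> i l j \<omega> - 0) / \<sigma> i) std_normal_density"
    using normal[OF i] normal_standard_normal_convert[OF \<sigma>[OF i]] by blast
  then have "distr M lborel (\<eta> i l j) = std_normal_distribution"
    by (simp add: \<eta>_def distributed_distr_eq_density)
  then show "distr M borel (\<eta> i l j) = std_normal_distribution"
    by (metis distr_cong sets_lborel)
qed

lemma PCS_ge_hom_G:
  assumes h: "0 < h" and x: "x \<noteq> 0"
  shows "hom_G k n0 X x h \<le> fdhom_PCS M k h \<delta> n0 X \<beta> Y x"
proof -
  define \<eta> where "\<eta> i l j \<omega> = \<epsilon> i l j \<omega> / \<sigma> i" for i l j \<omega>
  define q where "q = lever x \<bullet> lever x"
  define \<tau> where "\<tau> i = stage_size h \<delta> n0 (real df) (\<sigma> i)" for i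
  define a where "a i s = \<sigma> i * sqrt q / sqrt (real (\<tau> i s))" for i s
  obtain B where B: "orthonormal_basis_of (range ((*v) X)) B"
    using orthonormal_basis_of_exists[OF linear_subspace_image[OF matrix_vector_mul_linear subspace_UNIV]] .
  define C where "C i \<omega> = rss_stat n0 B (\<lambda>l. \<chi> j. \<eta> i l j \<omega>)" for i \<omega>
  define W where "W i \<omega> = mean_stat (lever x) (\<tau> i (C i \<omega>)) (\<lambda>l. \<chi> j. \<eta> i l j \<omega>)" for i \<omega>
  let ?Q = "chisq_distribution (real df)" and ?N = std_normal_distribution
  interpret Q: prob_space ?Q by (rule prob_space_chisq_distribution[OF df_pos])
  have n0': "0 < n0" using n0 by simp
  have q: "0 < q" using x by (simp add: q_def lever_eq_0_iff)
  have q_eq: "x \<bullet> (matrix_inv (transpose X ** X) *v x) = q"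
    by (simp add: q_def lever_sq Ginv_def)
  have cB: "card B = CARD('p)" using B dim_range_design by (simp add: orthonormal_basis_of_def)
  have \<tau>m[measurable]: "\<tau> i \<in> borel \<rightarrow>\<^sub>M count_space UNIV" for i unfolding \<tau>_def by measurable
  have \<tau>ge: "n0 \<le> \<tau> i s" for i s unfolding \<tau>_def by (rule stage_size_ge)
  have am[measurable]: "a i \<in> borel_measurable borel" for i unfolding a_def by measurable
  have apos: "0 < a i s" if "i < k" for i s
  proof -
    have "0 < \<tau> i s" using n0' \<tau>ge by (rule less_le_trans)
    then show ?thesis using \<sigma>[OF that] q by (simp add: a_def)
  qed
  have est: "x \<bullet> fdhom_beta h \<delta> n0 X (\<lambda>l. Y i l \<omega>) - x \<bullet> \<beta> i = a i (C i \<omega>) * W i \<omega>" if i: "i < k" for i \<omega>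
  proof -
    have "(1 / \<sigma> i) *\<^sub>R (\<chi> j. \<epsilon> i l j \<omega>) = (\<chi> j. \<eta> i l j \<omega>)" for l
      by (simp add: \<eta>_def vec_eq_iff)
    then show ?thesis
      using inner_fdhom_beta_eq[OF n0' B \<sigma>[OF i] x, of h \<delta> "\<beta> i" "\<lambda>l. \<chi> j. \<epsilon> i l j \<omega>"]
      by (simp add: Y_eq a_def W_def C_def \<tau>_def q_def dof_df)
  qed
  have "\<exists>i0<k. (MAX i\<in>{..<k}. x \<bullet> \<beta> i) = x \<bullet> \<beta> i0"
  proof -
    have "(MAX i\<in>{..<k}. x \<bullet> \<beta> i) \<in> (\<lambda>i. x \<bullet> \<beta> i) ` {..<k}" using k by (intro Max_in) auto
    then show ?thesis by auto
  qed
  then obtain i0 where i0: "i0 < k" "(MAX i\<in>{..<k}. x \<bullet> \<beta> i) = x \<bullet> \<beta> i0" by auto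
  define J where "J = {..<k} - {i0}"
  have J: "finite J" "i0 \<notin> J" "insert i0 J = {..<k}" "card J = k - 1" using i0 by (auto simp: J_def)
  define P where "P = PiM {..<k} (\<lambda>_. ?Q \<Otimes>\<^sub>M ?N)"
  let ?T = "\<lambda>\<omega>. \<lambda>i\<in>{..<k}. (C i \<omega>, W i \<omega>)"
  have law: "distr M (PiM {..<k} (\<lambda>_. borel \<Otimes>\<^sub>M borel)) ?T = P"
    unfolding P_def df_def cB[symmetric] C_def W_def
    by (rule two_stage_statistics_distr_PiM[OF k])
      (use standardized_errors B n0' \<tau>ge lever_in_range x dof_gt_0[OF n0] in
        \<open>auto simp: \<eta>_def[abs_def] orthonormal_basis_of_def lever_eq_0_iff cB\<close>)
  have spP: "space P = space (PiM {..<k} (\<lambda>_. borel \<Otimes>\<^sub>M borel :: (real \<times> real) measure))"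
    unfolding law[symmetric] by simp
  let ?E = "{p \<in> space P. \<forall>j\<in>J. a j (fst (p j)) * snd (p j) < a i0 (fst (p i0)) * snd (p i0) + \<delta>}"
  let ?E' = "{\<omega> \<in> space M. \<forall>j\<in>J. a j (C j \<omega>) * W j \<omega> < a i0 (C i0 \<omega>) * W i0 \<omega> + \<delta>}"
  let ?S = "{\<omega> \<in> space M. (MAX i\<in>{..<k}. x \<bullet> \<beta> i) - x \<bullet> \<beta> (fdhom_select k h \<delta> n0 X (\<lambda>i l. Y i l \<omega>) x) < \<delta>}"
  have Ssets: "?S \<in> sets M"
  proof -
    have "?S = Pair x -` {z \<in> space (borel \<Otimes>\<^sub>M M). (MAX i\<in>{..<k}. fst z \<bullet> \<beta> i)
      - fst z \<bullet> \<beta> (fdhom_select k h \<delta> n0 X (\<lambda>i l. Y i l (snd z)) (fst z)) < \<delta>}"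
      by (auto simp: space_pair_measure)
    then show ?thesis using sets_Pair1[OF PCS_set_measurable] by simp
  qed
  have sub: "?E' \<subseteq> ?S"
  proof safe
    fix \<omega> assume ev: "\<forall>j\<in>J. a j (C j \<omega>) * W j \<omega> < a i0 (C i0 \<omega>) * W i0 \<omega> + \<delta>"
    show "(MAX i\<in>{..<k}. x \<bullet> \<beta> i) - x \<bullet> \<beta> (fdhom_select k h \<delta> n0 X (\<lambda>i l. Y i l \<omega>) x) < \<delta>"
      unfolding fdhom_select_def
    proof (rule selection_correct[OF k i0 _ \<delta>])
      fix j assume "j < k" "j \<noteq> i0"
      then show "x \<bullet> fdhom_beta h \<delta> n0 X (\<lambda>l. Y j l \<omega>) - x \<bullet> \<beta> j
          < x \<bullet> fdhom_beta h \<delta> n0 X (\<lambda>l. Y i0 l \<omega>) - x \<bullet> \<beta> i0 + \<delta>"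
        using ev i0 est[of j \<omega>] est[of i0 \<omega>] by (simp add: J_def)
    qed
  qed
  let ?pp = "pairwise_prob (real df) q h"
  note [measurable] = borel_measurable_pairwise_prob[OF df_pos]
  note ppb = pairwise_prob_bounds[OF df_pos]
  have ppnn: "ennreal (?pp t) = (\<integral>\<^sup>+s. ennreal (std_normal_cdf (h / sqrt (real df * (1 / t + 1 / s) * q))) \<partial>?Q)" for t
    unfolding pairwise_prob_def
    by (rule nn_integral_eq_integral[symmetric])
      (auto intro!: Q.integrable_unit_interval simp: std_normal_cdf_nonneg std_normal_cdf_le_1)
  have "ennreal (hom_G k n0 X x h) = (\<integral>\<^sup>+t. ennreal (?pp t ^ (k - 1)) \<partial>?Q)"
    unfolding hom_G_eq[OF dof_df df_pos] q_eq using ppb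
    by (intro nn_integral_eq_integral[symmetric] Q.integrable_unit_interval) (auto intro: power_le_one)
  also have "\<dots> \<le> (\<integral>\<^sup>+t. (\<Prod>j\<in>J. \<integral>\<^sup>+s. ennreal (std_normal_cdf (\<delta> / sqrt ((a j s)\<^sup>2 + (a i0 t)\<^sup>2))) \<partial>?Q) \<partial>?Q)"
  proof (rule nn_integral_mono_AE)
    show "AE t in ?Q. ennreal (?pp t ^ (k - 1))
        \<le> (\<Prod>j\<in>J. \<integral>\<^sup>+s. ennreal (std_normal_cdf (\<delta> / sqrt ((a j s)\<^sup>2 + (a i0 t)\<^sup>2))) \<partial>?Q)"
      using AE_chisq_distribution_pos
    proof eventually_elim
      case (elim t)
      have "ennreal (?pp t ^ (k - 1)) = (\<Prod>j\<in>J. ennreal (?pp t))"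
        using ppb J by (simp add: ennreal_power)
      also have "\<dots> \<le> (\<Prod>j\<in>J. \<integral>\<^sup>+s. ennreal (std_normal_cdf (\<delta> / sqrt ((a j s)\<^sup>2 + (a i0 t)\<^sup>2))) \<partial>?Q)"
      proof (rule prod_mono_ennreal)
        fix j assume j: "j \<in> J"
        show "ennreal (?pp t) \<le> (\<integral>\<^sup>+s. ennreal (std_normal_cdf (\<delta> / sqrt ((a j s)\<^sup>2 + (a i0 t)\<^sup>2))) \<partial>?Q)"
          unfolding ppnn
        proof (rule nn_integral_mono_AE)
          show "AE s in ?Q. ennreal (std_normal_cdf (h / sqrt (real df * (1 / t + 1 / s) * q)))
              \<le> ennreal (std_normal_cdf (\<delta> / sqrt ((a j s)\<^sup>2 + (a i0 t)\<^sup>2)))"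
            using AE_chisq_distribution_pos
          proof eventually_elim
            case (elim s)
            have "h / sqrt (real df * (1 / t + 1 / s) * q) \<le> \<delta> / sqrt ((a j s)\<^sup>2 + (a i0 t)\<^sup>2)"
              unfolding a_def \<tau>_def using j i0 \<sigma> h \<delta> q df_pos elim \<open>0 < t\<close>
              by (intro stage_size_margin stage_size_ge_real) (auto simp: J_def)
            then show ?case by (intro ennreal_leI monoD[OF mono_std_normal_cdf])
          qed
        qed
      qed
      finally show ?case .
    qed
  qed
  also have "\<dots> \<le> emeasure P ?E"
    unfolding P_def J(3)[symmetric]
    by (rule selection_bound_PiM[OF Q.prob_space_axioms _ J(1,2) am]) (use apos J(3) in auto)
  also have "emeasure P ?E = emeasure M ?E'"
  proof -
    have Tm: "?T \<in> M \<rightarrow>\<^sub>M PiM {..<k} (\<lambda>_. borel \<Otimes>\<^sub>M borel)"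
    proof (rule measurable_restrict)
      fix i assume "i \<in> {..<k}"
      then have em: "\<eta> i l j \<in> borel_measurable M" for l j
        unfolding \<eta>_def[abs_def] using \<epsilon>_measurable by auto
      have [measurable]: "C i \<in> borel_measurable M"
        unfolding C_def[abs_def] by (rule measurable_stats[OF em])
      have [measurable]: "(\<lambda>\<omega>. mean_stat (lever x) n (\<lambda>l. \<chi> j. \<eta> i l j \<omega>)) \<in> borel_measurable M" for n
        by (rule measurable_stats[OF em])
      have [measurable]: "W i \<in> borel_measurable M"
        unfolding W_def[abs_def]
        by (rule measurable_compose_countable[where g="\<lambda>\<omega>. \<tau> i (C i \<omega>)"
              and f="\<lambda>n \<omega>. mean_stat (lever x) n (\<lambda>l. \<chi> j. \<eta> i l j \<omega>)"]) measurable
      show "(\<lambda>\<omega>. (C i \<omega>, W i \<omega>)) \<in> M \<rightarrow>\<^sub>M borel \<Otimes>\<^sub>M borel" by measurable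
    qed
    have Em: "?E \<in> sets (PiM {..<k} (\<lambda>_. borel \<Otimes>\<^sub>M borel))"
    proof -
      have comp: "(\<lambda>p. p i) \<in> PiM {..<k} (\<lambda>_. borel \<Otimes>\<^sub>M borel) \<rightarrow>\<^sub>M (borel \<Otimes>\<^sub>M borel :: (real \<times> real) measure)"
        if "i < k" for i using that by (intro measurable_component_singleton) auto
      have "(\<lambda>p. a i (fst (p i)) * snd (p i)) \<in> borel_measurable (PiM {..<k} (\<lambda>_. borel \<Otimes>\<^sub>M borel))" if "i < k" for i
        using comp[OF that] by measurable
      then show ?thesis unfolding spP using J(1) i0
        by (intro sets.sets_Collect_finite_All borel_measurable_less borel_measurable_add borel_measurable_const)
          (auto simp: J_def)
    qed
    have "emeasure P ?E = emeasure M (?T -` ?E \<inter> space M)"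
      unfolding law[symmetric] by (rule emeasure_distr[OF Tm]) (use Em in \<open>simp add: spP\<close>)
    also have "?T -` ?E \<inter> space M = ?E'"
    proof -
      have "?T \<omega> \<in> space P" if "\<omega> \<in> space M" for \<omega>
        unfolding spP using measurable_space[OF Tm that] .
      then show ?thesis using i0 by (auto simp: J_def)
    qed
    finally show ?thesis .
  qed
  also have "\<dots> \<le> emeasure M ?S" by (rule emeasure_mono[OF sub Ssets])
  finally show ?thesis
    by (simp add: fdhom_PCS_def emeasure_eq_measure)
qed

end

theorem theorem1:
  fixes M :: "'a measure" and PX :: "(real^'p::finite) measure"
    and \<Theta> :: "(real^'p) set" and xs :: "'m::finite \<Rightarrow> real^'p"
    and k n0 :: nat and \<alpha> \<delta> h :: real
    and \<beta> :: "nat \<Rightarrow> real^'p" and \<sigma> :: "nat \<Rightarrow> real"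
    and \<epsilon> :: "nat \<Rightarrow> nat \<Rightarrow> 'm \<Rightarrow> 'a \<Rightarrow> real"
  assumes k_pos: "0 < k"
    and alpha: "1 / real k < 1 - \<alpha>" "1 - \<alpha> < 1"
    and delta: "0 < \<delta>"
    and n0: "2 \<le> n0"
    \<comment> \<open>covariates: augmented vectors with intercept coordinate c0, distribution PX on Theta\<close>
    and intercept: "\<exists>c0. \<forall>x\<in>\<Theta>. x $ c0 = 1"
    and PX: "prob_space PX" "sets PX = sets borel" "\<Theta> \<in> sets borel" "AE x in PX. x \<in> \<Theta>"
    \<comment> \<open>fixed design\<close>
    and design: "\<forall>j. xs j \<in> \<Theta>"
    and A2: "invertible (transpose (design_matrix xs) ** design_matrix xs)"
    \<comment> \<open>(A1) with (A3): independent normal errors, variance sigma_i^2 not depending on x\<close>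
    and M: "prob_space M"
    and sigma: "\<forall>i<k. 0 < \<sigma> i"
    and normal: "\<forall>i<k. \<forall>l j. distributed M lborel (\<epsilon> i l j) (normal_density 0 (\<sigma> i))"
    and indep: "prob_space.indep_vars M (\<lambda>_. borel) (\<lambda>(i, l, j). \<epsilon> i l j) ({..<k} \<times> UNIV \<times> UNIV)"
  shows
    "((\<integral>x. hom_G k n0 (design_matrix xs) x h \<partial>PX) = 1 - \<alpha> \<longrightarrow>
        (\<integral>x. fdhom_PCS M k h \<delta> n0 (design_matrix xs) \<beta>
               (\<lambda>i l \<omega>. \<chi> j. xs j \<bullet> \<beta> i + \<epsilon> i l j \<omega>) x \<partial>PX) \<ge> 1 - \<alpha>)
     \<and> ((INF x\<in>\<Theta>. hom_G k n0 (design_matrix xs) x h) = 1 - \<alpha> \<longrightarrow>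
        (INF x\<in>\<Theta>. fdhom_PCS M k h \<delta> n0 (design_matrix xs) \<beta>
               (\<lambda>i l \<omega>. \<chi> j. xs j \<bullet> \<beta> i + \<epsilon> i l j \<omega>) x) \<ge> 1 - \<alpha>)"
proof -
  interpret PX: prob_space PX by (rule PX(1))
  interpret fdhom_model M xs k n0 \<delta> \<beta> \<sigma> \<epsilon>
    using M A2 k_pos delta n0 sigma normal indep
    by (intro fdhom_model.intro full_rank_design.intro fdhom_model_axioms.intro) auto
  let ?G = "\<lambda>x. hom_G k n0 X x h" and ?PCS = "\<lambda>x. fdhom_PCS M k h \<delta> n0 X \<beta> Y x"
  have Y: "(\<lambda>i l \<omega>. \<chi> j. xs j \<bullet> \<beta> i + \<epsilon> i l j \<omega>) = Y" by (simp add: Y_def fun_eq_iff)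
  have nz: "x \<noteq> 0" if "x \<in> \<Theta>" for x using intercept that by auto
  have small: "?G x \<le> 1 / real k" if "h \<le> 0" for x
  proof (rule hom_G_le_of_nonpos[OF dof_df df_pos _ that k_pos])
    show "0 \<le> x \<bullet> (matrix_inv (transpose X ** X) *v x)"
      using lever_sq[of x] inner_ge_zero[of "lever x"] by (simp add: Ginv_def)
  qed
  have valid: "?G x \<le> ?PCS x" if "0 < h" "x \<in> \<Theta>" for x
    using PCS_ge_hom_G[OF that(1) nz[OF that(2)]] .
  have "0 < 1 / real k" using k_pos by simp
  have "1 - \<alpha> \<le> (\<integral>x. ?PCS x \<partial>PX)" if I: "(\<integral>x. ?G x \<partial>PX) = 1 - \<alpha>"
  proof -
    have int: "integrable PX ?G"
    proof (rule ccontr)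
      assume "\<not> integrable PX ?G"
      then have "(\<integral>x. ?G x \<partial>PX) = 0" by (rule not_integrable_integral_eq)
      then show False using I alpha \<open>0 < 1 / real k\<close> by linarith
    qed
    have h: "0 < h"
    proof (rule ccontr)
      assume "\<not> 0 < h"
      then have "(\<integral>x. ?G x \<partial>PX) \<le> 1 / real k"
        using small by (intro PX.integral_le_const int AE_I2) auto
      then show False using I alpha by linarith
    qed
    have "integrable PX ?PCS"
      using PCS_measurable[of h] PX(2)
      by (intro PX.integrable_unit_interval) (auto simp: fdhom_PCS_def cong: measurable_cong_sets)
    moreover have "AE x in PX. ?G x \<le> ?PCS x" using PX(4) by eventually_elim (rule valid[OF h])
    ultimately have "(\<integral>x. ?G x \<partial>PX) \<le> (\<integral>x. ?PCS x \<partial>PX)" by (intro integral_mono_AE int)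
    then show ?thesis using I by simp
  qed
  moreover have "1 - \<alpha> \<le> (INF x\<in>\<Theta>. ?PCS x)" if I: "(INF x\<in>\<Theta>. ?G x) = 1 - \<alpha>"
  proof -
    have lower: "1 - \<alpha> \<le> ?G x" if "x \<in> \<Theta>" for x
      unfolding I[symmetric] using hom_G_nonneg[OF dof_df df_pos]
      by (intro cINF_lower that bdd_belowI2[where m=0])
    have "xs undefined \<in> \<Theta>" using design by blast
    then have h: "0 < h" using lower[of "xs undefined"] small[of "xs undefined"] alpha by linarith
    show ?thesis
      using \<open>xs undefined \<in> \<Theta>\<close> lower valid[OF h] by (intro cINF_greatest) (auto intro: order_trans)
  qed
  ultimately show ?thesis unfolding Y by blast
qed

end
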